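(* Let $\kappa$ be an infinite cardinal and $D$ a $\kappa$-uniform tournament with $|V(D)|=\kappa$, $V=V(D)$. Then there are $\mathcal C\in\mathrm{rs}(D)$ and sets $V^+,V^-$ with $V=V^+\cup V^-$ such that (1) every vertex of $D^{\mathcal C}\upharpoonright V^+$ has in-degree (in $D^{\mathcal C}\upharpoonright V^+$) less than $\kappa$; (2) every vertex of $D^{\mathcal C}\upharpoonright V^-$ has out-degree (in $D^{\mathcal C}\upharpoonright V^-$) less than $\kappa$; and (3) every strong component of $D^{\mathcal C}$ is contained either in $V^+$ or in $V^-$.
   Context: A tournament is a digraph (no loops) in which for all distinct $u,v$ exactly one of $uv$, $vu$ is an arc. $D$ is $\kappa$-uniform if $|N^+(v)\,\Delta\,N^+(v')|<\kappa$ and $|N^-(v)\,\Delta\,N^-(v')|<\kappa$ for all $v,v'\in V(D)$ ($\Delta$ symmetric difference). $H\upharpoonright A$ is the induced subdigraph on $A$. For a directed cycle $C$, $D^{C}$ is the digraph on $V(D)$ with arc set $(A(D)\setminus A(C))\cup\{vu: uv\in A(C)\}$. Reversal sequences $\mathrm{rs}(D)$ and $D^{\mathcal C}$ are defined by transfinite recursion: (1) $\emptyset\in\mathrm{rs}(D)$, $D^\emptyset=D$; (2) if $\mathcal C\in\mathrm{rs}(D)$ and $C^*$ is a directed cycle of $D^{\mathcal C}$ then $\mathcal C^\frown\langle C^*\rangle\in\mathrm{rs}(D)$ and $D^{\mathcal C^\frown\langle C^*\rangle}=(D^{\mathcal C})^{C^*}$; (3) if $\mathcal C_\xi\in\mathrm{rs}(D)$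 ($\xi<\zeta$) is an increasing (end-extending) sequence whose union $\mathcal C$ is locally finite (each edge lies in only finitely many cycles of $\mathcal C$), then $\mathcal C\in\mathrm{rs}(D)$ and $uv\in A(D^{\mathcal C})$ iff for some $\nu<\zeta$, $uv\in A(D^{\mathcal C_\xi})$ for all $\nu<\xi<\zeta$. Strong components are maximal induced subdigraphs in which any two vertices are mutually reachable by directed paths. *)

theory Defs
  imports "Graph_Theory.Graph_Theory"
begin

unbundle cardinal_syntax

section \<open>Tournaments and uniformity\<close>

text \<open>
  Digraphs have no parallel arcs, so they are rendered as \<^typ>\<open>'a pair_pre_digraph\<close>; the vertex
  set may be infinite.
\<close>

locale tournament = pair_loopfree_digraph G for G :: "'a pair_pre_digraph" +
  assumes exactly_one_arc:
    "\<lbrakk>u \<in> pverts G; v \<in> pverts G; u \<noteq> v\<rbrakk> \<Longrightarrow> (u, v) \<in> parcs G \<longleftrightarrow> (v, u) \<notin> parcs G"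

definition out_nbhd :: "'a pair_pre_digraph \<Rightarrow> 'a \<Rightarrow> 'a set" where
  "out_nbhd D v = {w. (v, w) \<in> parcs D}"

definition in_nbhd :: "'a pair_pre_digraph \<Rightarrow> 'a \<Rightarrow> 'a set" where
  "in_nbhd D v = {w. (w, v) \<in> parcs D}"

definition uniform :: "'b rel \<Rightarrow> 'a pair_pre_digraph \<Rightarrow> bool" where
  "uniform \<kappa> D \<longleftrightarrow> (\<forall>v \<in> pverts D. \<forall>v' \<in> pverts D.
     |sym_diff (out_nbhd D v) (out_nbhd D v')| <o \<kappa> \<and>
     |sym_diff (in_nbhd D v) (in_nbhd D v')| <o \<kappa>)"


section \<open>Ordinals\<close>

text \<open>
  The ordinals below the successor cardinal of \<open>max |'a| \<aleph>\<^sub>0\<close>. They suffice to index every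
  reversal sequence of a digraph with vertices in \<^typ>\<open>'a\<close>: such a sequence is locally finite and
  each of its cycles contains an edge, so it has at most \<open>max |'a| \<aleph>\<^sub>0\<close> entries.
\<close>

typedef 'a ordinal = "Field (cardSuc |UNIV :: ('a + nat) set| )"
proof -
  have "infinite (Field (cardSuc |UNIV :: ('a + nat) set| ))"
    using cardSuc_finite[OF card_of_Card_order, of "UNIV :: ('a + nat) set"]
    by (simp add: Field_card_of)
  then show ?thesis
    by (metis finite.emptyI ex_in_conv)
qed

instantiation ordinal :: (type) wellorder
begin

definition less_eq_ordinal :: "'a ordinal \<Rightarrow> 'a ordinal \<Rightarrow> bool" where
  "\<alpha> \<le> \<beta> \<longleftrightarrow> (Rep_ordinal \<alpha>, Rep_ordinal \<beta>) \<in> cardSuc |UNIV :: ('a + nat) set|"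

definition less_ordinal :: "'a ordinal \<Rightarrow> 'a ordinal \<Rightarrow> bool" where
  "\<alpha> < \<beta> \<longleftrightarrow> \<alpha> \<le> \<beta> \<and> \<alpha> \<noteq> (\<beta> :: 'a ordinal)"

instance
proof -
  let ?r = "cardSuc |UNIV :: ('a + nat) set|"
  have wo: "Well_order ?r"
    by (simp add: cardSuc_Well_order card_of_Card_order)
  have rf: "refl_on (Field ?r) ?r" and tr: "trans ?r" and an: "antisym ?r"
    and tot: "total_on (Field ?r) ?r" and wfr: "wf (?r - Id)"
    using wo by (auto simp: well_order_on_def linear_order_on_def partial_order_on_def
        preorder_on_def)
  show "OFCLASS('a ordinal, wellorder_class)"
  proof
    fix x y z :: "'a ordinal"
    show refl: "x \<le> x"
      using rf Rep_ordinal[of x] by (auto simp: less_eq_ordinal_def refl_on_def)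
    show "x \<le> z" if "x \<le> y" "y \<le> z"
      using that tr unfolding less_eq_ordinal_def by (blast dest: transD)
    show anti: "x = y" if "x \<le> y" "y \<le> x"
      using that an unfolding less_eq_ordinal_def by (metis antisymD Rep_ordinal_inject)
    show "(x < y) = (x \<le> y \<and> \<not> y \<le> x)"
      using anti refl by (auto simp: less_ordinal_def)
    show "x \<le> y \<or> y \<le> x"
      using tot rf Rep_ordinal[of x] Rep_ordinal[of y] refl
      unfolding less_eq_ordinal_def total_on_def refl_on_def by metis
  next
    fix P :: "'a ordinal \<Rightarrow> bool" and a
    assume step: "\<And>x. (\<And>y. y < x \<Longrightarrow> P y) \<Longrightarrow> P x"
    have "wf (inv_image (?r - Id) (Rep_ordinal :: 'a ordinal \<Rightarrow> _))"
      using wfr by (rule wf_inv_image)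
    then show "P a"
    proof (induction a rule: wf_induct_rule)
      case (less x)
      show ?case
        by (rule step, rule less)
          (auto simp: in_inv_image less_ordinal_def less_eq_ordinal_def Rep_ordinal_inject)
    qed
  qed
qed

end

definition limit_ordinal :: "'a ordinal \<Rightarrow> bool" where
  "limit_ordinal \<zeta> \<longleftrightarrow> (\<exists>\<xi>. \<xi> < \<zeta>) \<and> (\<forall>\<xi><\<zeta>. \<exists>\<eta>. \<xi> < \<eta> \<and> \<eta> < \<zeta>)"


section \<open>Cycle reversals\<close>

text \<open>A directed cycle is represented by its arc set, which determines it.\<close>

definition directed_cycles :: "'a pair_pre_digraph \<Rightarrow> 'a rel set" where
  "directed_cycles D = {set p | p. pre_digraph.cycle (with_proj D) p}"

definition reverse_cycle :: "'a pair_pre_digraph \<Rightarrow> 'a rel \<Rightarrow> 'a pair_pre_digraph" where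
  "reverse_cycle D C = D\<lparr>parcs := (parcs D - C) \<union> C\<inverse>\<rparr>"

text \<open>
  A transfinite sequence of cycles is a partial map on the ordinals; those generated below have an
  initial segment \<open>{..<\<alpha>}\<close> as domain, so that \<open>\<subseteq>\<^sub>m\<close> between them is end-extension.
\<close>

type_synonym 'a cycle_seq = "'a ordinal \<rightharpoonup> 'a rel"

text \<open>
  Edges are unordered, as their orientation changes along the sequence, and occurrences are counted
  with multiplicity, that is, by position.
\<close>

definition positions_through :: "'a cycle_seq \<Rightarrow> 'a \<Rightarrow> 'a \<Rightarrow> 'a ordinal set" where
  "positions_through \<C> u v = {\<xi>. \<exists>C. \<C> \<xi> = Some C \<and> ((u, v) \<in> C \<or> (v, u) \<in> C)}"

definition locally_finite :: "'a cycle_seq \<Rightarrow> bool" where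
  "locally_finite \<C> \<longleftrightarrow> (\<forall>u v. finite (positions_through \<C> u v))"

text \<open>\<open>reversal D \<C> E\<close>: \<open>\<C>\<close> is a reversal sequence of \<open>D\<close> with outcome \<open>E\<close>.\<close>

inductive reversal :: "'a pair_pre_digraph \<Rightarrow> 'a cycle_seq \<Rightarrow> 'a pair_pre_digraph \<Rightarrow> bool"
  for D :: "'a pair_pre_digraph" where
  empty: "reversal D Map.empty D"
| snoc: "reversal D (\<C>(\<alpha> \<mapsto> C)) (reverse_cycle E C)"
    if "reversal D \<C> E" "dom \<C> = {..<\<alpha>}" "C \<in> directed_cycles E"
| limit: "reversal D \<C>
      (D\<lparr>parcs := {(u, v). \<exists>\<nu><\<zeta>. \<forall>\<xi>. \<nu> < \<xi> \<and> \<xi> < \<zeta> \<longrightarrow> (u, v) \<in> parcs (E \<xi>)}\<rparr>)"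
    if "limit_ordinal (\<zeta> :: 'a ordinal)" "\<And>\<xi>. \<xi> < \<zeta> \<Longrightarrow> reversal D (\<S> \<xi>) (E \<xi>)"
      "\<And>\<xi> \<eta>. \<xi> < \<eta> \<Longrightarrow> \<eta> < \<zeta> \<Longrightarrow> \<S> \<xi> \<subseteq>\<^sub>m \<S> \<eta>"
      "Map.graph \<C> = (\<Union>\<xi>\<in>{..<\<zeta>}. Map.graph (\<S> \<xi>))" "locally_finite \<C>"

definition rs :: "'a pair_pre_digraph \<Rightarrow> 'a cycle_seq set" where
  "rs D = {\<C>. \<exists>E. reversal D \<C> E}"

definition reversed :: "'a pair_pre_digraph \<Rightarrow> 'a cycle_seq \<Rightarrow> 'a pair_pre_digraph" where
  "reversed D \<C> = (THE E. reversal D \<C> E)"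


subsection \<open>The outcome of a reversal sequence is unique\<close>

fun reverse_step :: "'a \<Rightarrow> 'a \<Rightarrow> 'a rel \<Rightarrow> bool \<times> bool \<Rightarrow> bool \<times> bool" where
  "reverse_step u v C (a, b) =
     ((a \<and> (u, v) \<notin> C) \<or> (v, u) \<in> C, (b \<and> (v, u) \<notin> C) \<or> (u, v) \<in> C)"

definition pair_outcome :: "'a pair_pre_digraph \<Rightarrow> 'a cycle_seq \<Rightarrow> 'a \<Rightarrow> 'a \<Rightarrow> bool \<times> bool" where
  "pair_outcome D \<C> u v = fold (\<lambda>\<xi>. reverse_step u v (the (\<C> \<xi>)))
     (sorted_list_of_set (positions_through \<C> u v)) ((u, v) \<in> parcs D, (v, u) \<in> parcs D)"

lemma pair_outcome_mono:
  assumes "\<S> \<subseteq>\<^sub>m \<C>" "positions_through \<S> u v = positions_through \<C> u v"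
    "finite (positions_through \<C> u v)"
  shows "pair_outcome D \<S> u v = pair_outcome D \<C> u v"
proof -
  have "the (\<S> \<xi>) = the (\<C> \<xi>)" if "\<xi> \<in> positions_through \<C> u v" for \<xi>
    using that assms(1,2) by (force simp: positions_through_def map_le_def)
  then show ?thesis
    unfolding pair_outcome_def assms(2) using assms(3) by (intro fold_cong) auto
qed

lemma pverts_reversal: "reversal D \<C> E \<Longrightarrow> pverts E = pverts D"
  by (induction rule: reversal.induct) (auto simp: reverse_cycle_def)

lemma reversal_outcome:
  assumes "reversal D \<C> E"
  shows "locally_finite \<C> \<and>
    (\<forall>u v. pair_outcome D \<C> u v = ((u, v) \<in> parcs E, (v, u) \<in> parcs E))"
  using assms
proof (induction rule: reversal.induct)
  case empty
  show ?case
    by (simp add: locally_finite_def positions_through_def pair_outcome_def)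
next
  case (snoc \<C> E \<alpha> C)
  have fin: "finite (positions_through \<C> u v)" for u v
    using snoc.IH by (simp add: locally_finite_def)
  have sub: "positions_through \<C> u v \<subseteq> {..<\<alpha>}" for u v
    using snoc.hyps(2) by (auto simp: positions_through_def)
  have \<alpha>: "\<C> \<alpha> = None"
    using snoc.hyps(2) by (metis domIff lessThan_iff less_irrefl)
  have le: "\<C> \<subseteq>\<^sub>m \<C>(\<alpha> \<mapsto> C)"
    using \<alpha> by (auto simp: map_le_def)
  have pos: "positions_through (\<C>(\<alpha> \<mapsto> C)) u v =
      (if (u, v) \<in> C \<or> (v, u) \<in> C then insert \<alpha> (positions_through \<C> u v)
       else positions_through \<C> u v)" for u v
    using \<alpha> by (auto simp: positions_through_def)
  have fin': "finite (positions_through (\<C>(\<alpha> \<mapsto> C)) u v)" for u v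
    by (simp add: pos fin)
  have "pair_outcome D (\<C>(\<alpha> \<mapsto> C)) u v =
      ((u, v) \<in> parcs (reverse_cycle E C), (v, u) \<in> parcs (reverse_cycle E C))" for u v
  proof (cases "(u, v) \<in> C \<or> (v, u) \<in> C")
    case False
    then have "pair_outcome D (\<C>(\<alpha> \<mapsto> C)) u v = pair_outcome D \<C> u v"
      using pair_outcome_mono[OF le, of u v D] fin by (simp add: pos)
    with False snoc.IH show ?thesis
      by (auto simp: reverse_cycle_def)
  next
    case True
    have "sorted_list_of_set (insert \<alpha> (positions_through \<C> u v)) =
        sorted_list_of_set (positions_through \<C> u v) @ [\<alpha>]"
      using fin[of u v] sub[of u v]
      by (intro sorted_distinct_set_unique)
        (auto simp: sorted_append less_imp_le simp del: sorted_list_of_set_insert_remove)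
    moreover have "fold (\<lambda>\<xi>. reverse_step u v (the ((\<C>(\<alpha> \<mapsto> C)) \<xi>)))
        (sorted_list_of_set (positions_through \<C> u v)) s =
      fold (\<lambda>\<xi>. reverse_step u v (the (\<C> \<xi>)))
        (sorted_list_of_set (positions_through \<C> u v)) s" for s
      using fin[of u v] sub[of u v] by (intro fold_cong) auto
    ultimately have "pair_outcome D (\<C>(\<alpha> \<mapsto> C)) u v = reverse_step u v C (pair_outcome D \<C> u v)"
      using True by (simp add: pair_outcome_def pos del: sorted_list_of_set_insert_remove)
    with snoc.IH show ?thesis
      by (auto simp: reverse_cycle_def)
  qed
  then show ?case
    using fin' unfolding locally_finite_def by blast
next
  case (limit \<zeta> \<S> E \<C>)
  have some: "\<C> \<alpha> = Some C \<longleftrightarrow> (\<exists>\<xi><\<zeta>. \<S> \<xi> \<alpha> = Some C)" for \<alpha> C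
  proof -
    have "\<C> \<alpha> = Some C \<longleftrightarrow> (\<alpha>, C) \<in> Map.graph \<C>"
      by (auto simp: Map.graph_def)
    also have "\<dots> \<longleftrightarrow> (\<exists>\<xi><\<zeta>. \<S> \<xi> \<alpha> = Some C)"
      unfolding limit.hyps(4) by (auto simp: Map.graph_def)
    finally show ?thesis .
  qed
  have le: "\<S> \<xi> \<subseteq>\<^sub>m \<C>" if "\<xi> < \<zeta>" for \<xi>
    using that some unfolding map_le_def by (metis domD)
  have "pair_outcome D \<C> u v = ((u, v) \<in> {(u, v). \<exists>\<nu><\<zeta>. \<forall>\<xi>. \<nu> < \<xi> \<and> \<xi> < \<zeta> \<longrightarrow> (u, v) \<in> parcs (E \<xi>)},
     (v, u) \<in> {(u, v). \<exists>\<nu><\<zeta>. \<forall>\<xi>. \<nu> < \<xi> \<and> \<xi> < \<zeta> \<longrightarrow> (u, v) \<in> parcs (E \<xi>)})" for u v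
  proof -
    let ?P = "positions_through \<C> u v"
    have fin: "finite ?P"
      using limit.hyps(5) by (simp add: locally_finite_def)
    have "\<exists>\<nu><\<zeta>. \<forall>\<alpha>\<in>A. \<alpha> \<in> positions_through (\<S> \<nu>) u v" if "finite A" "A \<subseteq> ?P" for A
      using that
    proof (induction A rule: finite_induct)
      case empty
      then show ?case
        using limit.hyps(1) by (auto simp: limit_ordinal_def)
    next
      case (insert \<beta> A)
      then obtain \<nu> where \<nu>: "\<nu> < \<zeta>" "\<forall>\<alpha>\<in>A. \<alpha> \<in> positions_through (\<S> \<nu>) u v"
        by auto
      obtain \<mu> where \<mu>: "\<mu> < \<zeta>" "\<beta> \<in> positions_through (\<S> \<mu>) u v"
        using insert.prems some by (auto simp: positions_through_def)
      have up: "positions_through (\<S> \<xi>) u v \<subseteq> positions_through (\<S> (max \<nu> \<mu>)) u v"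
        if "\<xi> = \<nu> \<or> \<xi> = \<mu>" for \<xi>
      proof -
        have "\<S> \<xi> \<subseteq>\<^sub>m \<S> (max \<nu> \<mu>)"
          using that limit.hyps(3)[of \<nu> \<mu>] limit.hyps(3)[of \<mu> \<nu>] \<nu>(1) \<mu>(1)
          by (cases \<nu> \<mu> rule: linorder_cases) (auto simp: max_def)
        then show ?thesis
          by (force simp: positions_through_def map_le_def dom_def)
      qed
      show ?case
        using up \<nu> \<mu> by (intro exI[of _ "max \<nu> \<mu>"]) auto
    qed
    from this[OF fin] obtain \<nu> where \<nu>: "\<nu> < \<zeta>" "?P \<subseteq> positions_through (\<S> \<nu>) u v"
      by auto
    have const: "pair_outcome D \<C> u v = ((u, v) \<in> parcs (E \<xi>), (v, u) \<in> parcs (E \<xi>))"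
      if "\<nu> < \<xi>" "\<xi> < \<zeta>" for \<xi>
    proof -
      have "positions_through (\<S> \<nu>) u v \<subseteq> positions_through (\<S> \<xi>) u v"
        using limit.hyps(3)[OF that] by (force simp: positions_through_def map_le_def dom_def)
      moreover have "positions_through (\<S> \<xi>) u v \<subseteq> ?P"
        using le[OF that(2)] by (force simp: positions_through_def map_le_def dom_def)
      ultimately have "positions_through (\<S> \<xi>) u v = ?P"
        using \<nu>(2) by auto
      then have "pair_outcome D (\<S> \<xi>) u v = pair_outcome D \<C> u v"
        using pair_outcome_mono[OF le[OF that(2)]] fin by simp
      then show ?thesis
        using limit.IH[OF that(2)] by simp
    qed
    obtain a b where ab: "pair_outcome D \<C> u v = (a, b)"
      by fastforce
    have ex: "\<exists>\<xi>. \<nu> < \<xi> \<and> \<mu> < \<xi> \<and> \<xi> < \<zeta>" if "\<mu> < \<zeta>" for \<mu>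
    proof -
      have "max \<nu> \<mu> < \<zeta>" using that \<nu>(1) by simp
      then show ?thesis
        using limit.hyps(1) unfolding limit_ordinal_def by (metis max_less_iff_conj)
    qed
    have "(\<exists>\<mu><\<zeta>. \<forall>\<xi>. \<mu> < \<xi> \<and> \<xi> < \<zeta> \<longrightarrow> (u, v) \<in> parcs (E \<xi>)) \<longleftrightarrow> a"
      using const ab ex \<nu>(1) by (metis prod.inject)
    moreover have "(\<exists>\<mu><\<zeta>. \<forall>\<xi>. \<mu> < \<xi> \<and> \<xi> < \<zeta> \<longrightarrow> (v, u) \<in> parcs (E \<xi>)) \<longleftrightarrow> b"
      using const ab ex \<nu>(1) by (metis prod.inject)
    ultimately show ?thesis
      using ab by simp
  qed
  with limit.hyps(5) show ?case
    by simp
qed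

lemma reversal_unique:
  assumes "reversal D \<C> E" "reversal D \<C> E'"
  shows "E = E'"
proof -
  have "parcs E = parcs E'"
    using reversal_outcome[OF assms(1)] reversal_outcome[OF assms(2)] by auto
  moreover have "pverts E = pverts E'"
    using assms by (simp add: pverts_reversal)
  ultimately show ?thesis
    by (simp add: pair_pre_digraph.equality)
qed

lemma reversed_eq: "reversal D \<C> E \<Longrightarrow> reversed D \<C> = E"
  unfolding reversed_def by (blast intro: the_equality reversal_unique)

end

theory Submission
  imports Defs "HOL-Library.Product_Lexorder" "HOL-Library.Diagonal_Subsequence"
begin

text \<open>
  By uniformity all out-neighbourhoods agree, up to fewer than \<open>\<kappa>\<close> vertices, with one set \<open>A\<close>. For
  every such \<open>A\<close> the sets \<open>V\<^sup>+ = A\<close> and \<open>V\<^sup>- = V - A\<close> satisfy the degree conditions, so it suffices to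
  get rid of the arcs leaving \<open>A\<close>. Choose \<open>A\<close> such that the number \<open>\<lambda>\<close> of leaving arcs is minimal.

  If \<open>\<lambda>\<close> is infinite, minimality provides, for every leaving arc \<open>(a, b)\<close> and every set \<open>S\<close> of fewer than
  \<open>\<lambda>\<close> arcs, a path from \<open>b\<close> to \<open>a\<close> that avoids \<open>S\<close>. So one can choose infinitely many such paths
  \<open>T\<^sub>1, T\<^sub>2, \<dots>\<close> for each leaving arc, all of them arc-disjoint. Reversing \<open>(a, b) + T\<^sub>1\<close>, then replacing
  the reversed path \<open>T\<^sub>1\<close> by \<open>T\<^sub>2\<close>, that one by \<open>T\<^sub>3\<close>, and so on, reverses in the limit the single arc
  \<open>(a, b)\<close>. Doing this for all leaving arcs one after the other reverses exactly these.

  If \<open>\<lambda>\<close> is finite, either the tails of the leaving arcs have fewer than \<open>\<kappa>\<close> ancestors within \<open>A\<close>, and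
  these can be removed from \<open>A\<close>; or some leaving arc \<open>(a, b)\<close> lies on infinitely many cycles
  \<open>b \<rightarrow> y\<^sub>n \<rightarrow> \<dots> \<rightarrow> a \<rightarrow> b\<close> with distinct \<open>y\<^sub>n\<close> and the part from \<open>y\<^sub>n\<close> to \<open>a\<close> inside \<open>A\<close>. A subsequence of
  these cycles converges pointwise, and reversing them in turn, each replacing its predecessor, reverses
  in the limit \<open>(a, b)\<close> and otherwise only arcs inside \<open>A\<close>.
\<close>

section \<open>Transfinite families of cycles\<close>

text \<open>Otherwise \<open>cardSuc |U|\<close> would embed into \<open>r\<close>, and
  \<open>Field r\<close> would have more than \<open>|U|\<close> elements.\<close>

lemma Well_order_ordLess_cardSuc:
  assumes "Well_order r" "|Field r| \<le>o |U|"
  shows "r <o cardSuc |U|"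
proof (rule ccontr)
  let ?c = "cardSuc |U|"
  have C: "Card_order ?c"
    by (simp add: cardSuc_Card_order card_of_Card_order)
  assume "\<not> r <o ?c"
  then have "?c \<le>o r"
    using not_ordLess_iff_ordLeq[of ?c r] assms(1) C card_order_on_well_order_on by blast
  then have "|Field ?c| \<le>o |Field r|"
    by (rule card_of_mono2)
  then have "?c \<le>o |Field r|"
    using card_of_Field_ordIso[OF C] ordIso_ordLeq_trans ordIso_symmetric by blast
  then have "?c \<le>o |U|"
    using assms(2) ordLeq_transitive by blast
  then show False
    using cardSuc_greater[OF card_of_Card_order, of U] not_ordLess_ordLeq by blast
qed

text \<open>The order \<open>r\<close> is isomorphic to the predecessors of some \<open>a\<close> in
  the successor cardinal behind \<open>'a ordinal\<close>, and \<open>Abs_ordinal\<close> carries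
  these onto \<open>{..<l}\<close>. This makes every well-ordered set of suitable size available as
  an index set.\<close>

lemma ordinal_enumeration:
  assumes "Well_order r" "|Field r| \<le>o |UNIV :: ('a + nat) set|"
  obtains f :: "'i \<Rightarrow> 'a ordinal" and l where "bij_betw f (Field r) {..<l}"
    "\<And>x y. x \<in> Field r \<Longrightarrow> y \<in> Field r \<Longrightarrow> (x, y) \<in> r \<longleftrightarrow> f x \<le> f y"
proof -
  let ?c = "cardSuc |UNIV :: ('a + nat) set|"
  have wc: "Well_order ?c"
    by (simp add: cardSuc_Well_order card_of_Card_order)
  obtain a where a: "a \<in> Field ?c" "r =o Restr ?c (underS ?c a)"
    using Well_order_ordLess_cardSuc[OF assms] ordLess_iff_ordIso_Restr[OF wc assms(1)] by blast
  have W': "Well_order (Restr ?c (underS ?c a))"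
    using wc by (rule Well_order_Restr)
  obtain g where "iso r (Restr ?c (underS ?c a)) g"
    using a(2) by (auto simp: ordIso_def)
  moreover have F: "Field (Restr ?c (underS ?c a)) = underS ?c a"
    using wc by (simp add: Field_Restr_ofilter wo_rel.underS_ofilter wo_rel_def)
  ultimately have g: "bij_betw g (Field r) (underS ?c a)"
    and ord: "\<And>x y. x \<in> Field r \<Longrightarrow> y \<in> Field r \<Longrightarrow> (x, y) \<in> r \<longleftrightarrow> (g x, g y) \<in> Restr ?c (underS ?c a)"
    using assms(1) W' by (auto simp: iso_iff2)
  define f :: "'i \<Rightarrow> 'a ordinal" where "f = Abs_ordinal \<circ> g"
  define l :: "'a ordinal" where "l = Abs_ordinal a"
  have u: "underS ?c a \<subseteq> Field ?c"
    by (auto simp: underS_def Field_def)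
  have 1: "bij_betw Abs_ordinal (underS ?c a) {..<l}"
  proof (rule bij_betwI')
    show "(Abs_ordinal x = Abs_ordinal y) = (x = y)" if "x \<in> underS ?c a" "y \<in> underS ?c a" for x y
      using Abs_ordinal_inject[of x y] that u by blast
    show "Abs_ordinal x \<in> {..<l}" if "x \<in> underS ?c a" for x
    proof -
      have x: "x \<in> Field ?c" "x \<noteq> a" "(x, a) \<in> ?c"
        using that u by (auto simp: underS_def)
      show ?thesis
        using x Abs_ordinal_inject[OF x(1) a(1)] Abs_ordinal_inverse[OF x(1)] Abs_ordinal_inverse[OF a(1)]
        by (simp add: l_def less_ordinal_def less_eq_ordinal_def)
    qed
    show "\<exists>x\<in>underS ?c a. y = Abs_ordinal x" if "y \<in> {..<l}" for y
    proof
      have "Rep_ordinal y \<noteq> a"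
        using that by (auto simp: l_def Rep_ordinal_inverse)
      then show "Rep_ordinal y \<in> underS ?c a"
        using that Abs_ordinal_inverse[OF a(1)]
        by (simp add: l_def less_ordinal_def less_eq_ordinal_def underS_def)
    qed (simp add: Rep_ordinal_inverse)
  qed
  have "bij_betw f (Field r) {..<l}"
    unfolding f_def using g 1 by (rule bij_betw_trans)
  moreover have "(x, y) \<in> r \<longleftrightarrow> f x \<le> f y" if "x \<in> Field r" "y \<in> Field r" for x y
  proof -
    have "g x \<in> underS ?c a" "g y \<in> underS ?c a"
      using that g by (auto simp: bij_betw_def)
    moreover from this have "g x \<in> Field ?c" "g y \<in> Field ?c"
      using u by blast+
    ultimately show ?thesis
      using ord[OF that] by (simp add: f_def less_eq_ordinal_def Abs_ordinal_inverse)
  qed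
  ultimately show thesis
    by (rule that)
qed

text \<open>Proper initial segments of a successor cardinal are no larger than the cardinal it
  succeeds.\<close>

lemma card_of_lessThan_ordinal: "|{..<l :: 'a ordinal}| \<le>o |UNIV :: ('a + nat) set|"
proof -
  let ?c = "cardSuc |UNIV :: ('a + nat) set|"
  have "|underS ?c (Rep_ordinal l)| <o ?c"
    by (intro card_of_underS cardSuc_Card_order card_of_Card_order Rep_ordinal)
  then have "|underS ?c (Rep_ordinal l)| \<le>o |UNIV :: ('a + nat) set|"
    by (simp add: cardSuc_ordLeq_ordLess card_of_Card_order)
  moreover have "|{..<l}| \<le>o |underS ?c (Rep_ordinal l)|"
    by (rule card_of_ordLeqI[of Rep_ordinal])
      (auto simp: inj_on_def Rep_ordinal_inject underS_def less_ordinal_def less_eq_ordinal_def)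
  ultimately show ?thesis
    using ordLeq_transitive by blast
qed

text \<open>An edge is oriented against its direction in the last cycle through it.\<close>

definition oriented ::
    "'a pair_pre_digraph \<Rightarrow> ('i :: order \<Rightarrow> 'a rel) \<Rightarrow> 'i set \<Rightarrow> 'a pair_pre_digraph" where
  "oriented D c J = D\<lparr>parcs := {(u, v).
     (\<exists>j\<in>J. (v, u) \<in> c j \<and> (\<forall>k\<in>J. j < k \<longrightarrow> (u, v) \<notin> c k \<and> (v, u) \<notin> c k)) \<or>
     ((u, v) \<in> parcs D \<and> (\<forall>j\<in>J. (u, v) \<notin> c j \<and> (v, u) \<notin> c j))}\<rparr>"

text \<open>A form of \<open>reversal\<close> without recursion: the digraph before step
  \<open>i\<close> is written down directly from the cycles at smaller indices, and the indices may
  come from any ordered type.\<close>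

definition admissible :: "'a pair_pre_digraph \<Rightarrow> ('i :: order \<Rightarrow> 'a rel) \<Rightarrow> 'i set \<Rightarrow> bool" where
  "admissible D c I \<longleftrightarrow>
     (\<forall>i\<in>I. c i \<in> directed_cycles (oriented D c {j \<in> I. j < i})) \<and>
     (\<forall>u v. finite {i \<in> I. (u, v) \<in> c i \<or> (v, u) \<in> c i})"

text \<open>The indices are the ordinals below \<open>l\<close>, so that \<open>c\<close> can be
  read as a sequence in \<open>rs D\<close>; other index sets are reduced to this form by
  \<open>cycle_reachable_if_admissible\<close>.\<close>

definition cycle_reachable :: "'a pair_pre_digraph \<Rightarrow> 'a pair_pre_digraph \<Rightarrow> bool" where
  "cycle_reachable D E \<longleftrightarrow>
     (\<exists>c (l :: 'a ordinal). admissible D c {..<l} \<and> E = oriented D c {..<l})"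

lemma parcs_oriented: "(u, v) \<in> parcs (oriented D c J) \<longleftrightarrow>
     (\<exists>j\<in>J. (v, u) \<in> c j \<and> (\<forall>k\<in>J. j < k \<longrightarrow> (u, v) \<notin> c k \<and> (v, u) \<notin> c k)) \<or>
     ((u, v) \<in> parcs D \<and> (\<forall>j\<in>J. (u, v) \<notin> c j \<and> (v, u) \<notin> c j))"
  by (simp add: oriented_def)

lemma oriented_eqI: 
  "(\<And>u v. (u, v) \<in> parcs (oriented D c J) \<longleftrightarrow> (u, v) \<in> parcs E) \<Longrightarrow> pverts E = pverts D
    \<Longrightarrow> oriented D c J = E"
  by (rule pair_pre_digraph.equality) (auto simp: oriented_def)

lemma pverts_oriented [simp]: "pverts (oriented D c J) = pverts D"
  by (simp add: oriented_def)

lemma oriented_empty [simp]: "oriented D c {} = D"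
  by (simp add: oriented_def)

text \<open>This is the \<open>snoc\<close> clause of \<open>reversal\<close>: a new top index has
  the last word on all edges of its cycle.\<close>

lemma oriented_insert_above:
  assumes "\<And>j. j \<in> J \<Longrightarrow> j < i"
  shows "oriented D c (insert i J) = reverse_cycle (oriented D c J) (c i)"
proof (rule oriented_eqI)
  fix u v
  have "\<not> i < j" if "j \<in> J" for j
    using assms[OF that] by (auto dest: less_asym)
  with assms show "(u, v) \<in> parcs (oriented D c (insert i J)) \<longleftrightarrow>
      (u, v) \<in> parcs (reverse_cycle (oriented D c J) (c i))"
    unfolding reverse_cycle_def by (simp add: parcs_oriented) blast
qed (simp add: reverse_cycle_def)

lemma oriented_superset:
  assumes "J \<subseteq> J'" "\<And>j. j \<in> J' - J \<Longrightarrow> (u, v) \<notin> c j \<and> (v, u) \<notin> c j"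
  shows "(u, v) \<in> parcs (oriented D c J) \<longleftrightarrow> (u, v) \<in> parcs (oriented D c J')"
  unfolding parcs_oriented using assms by blast

text \<open>The maximum of finitely many ordinals below a limit still has a larger one below that
  limit. Applied to the positions of the cycles through one edge.\<close>

lemma finite_bounded_below_limit:
  assumes "limit_ordinal \<zeta>" "finite P" "\<And>p. p \<in> P \<Longrightarrow> p < \<zeta>"
  shows "\<exists>\<nu><\<zeta>. \<forall>p\<in>P. p < \<nu>"
  using assms(2,3)
proof (induction P rule: finite_induct)
  case empty
  then show ?case
    using assms(1) by (auto simp: limit_ordinal_def)
next
  case (insert p P)
  then obtain \<nu> where "\<nu> < \<zeta>" "\<forall>p\<in>P. p < \<nu>"
    by auto
  moreover from this insert obtain \<mu> where "max \<nu> p < \<mu>" "\<mu> < \<zeta>"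
    using assms(1) unfolding limit_ordinal_def by (metis insertI1 max_less_iff_conj)
  ultimately show ?case
    by (intro exI[of _ \<mu>]) (auto dest: less_trans)
qed

text \<open>Induction on \<xi>, where zero, successor and limit ordinals correspond to the three
  clauses of \<open>reversal\<close>. At limits, local finiteness makes the orientation of each edge
  eventually constant.\<close>

lemma reversal_if_admissible:
  assumes "admissible D c {..<l :: 'a ordinal}"
  shows "\<xi> \<le> l \<Longrightarrow>
    reversal D (\<lambda>\<eta>. if \<eta> < \<xi> then Some (c \<eta>) else None) (oriented D c {..<\<xi>})"
proof (induction \<xi> rule: less_induct)
  case (less \<xi>)
  have fin: "finite {\<eta>. \<eta> < \<xi> \<and> ((u, v) \<in> c \<eta> \<or> (v, u) \<in> c \<eta>)}" for u v
    using assms less.prems unfolding admissible_def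
    by (elim conjE allE[of _ u] allE[of _ v], elim finite_subset[rotated]) auto
  consider (zero) "\<nexists>\<eta>. \<eta> < \<xi>" | (succ) \<eta> where "\<eta> < \<xi>" "\<nexists>\<mu>. \<eta> < \<mu> \<and> \<mu> < \<xi>" | (limit) "limit_ordinal \<xi>"
    unfolding limit_ordinal_def by blast
  then show ?case
  proof cases
    case zero
    then have "{..<\<xi>} = {}" "(\<lambda>\<eta>. if \<eta> < \<xi> then Some (c \<eta>) else None) = Map.empty"
      by auto
    then show ?thesis
      by (metis oriented_empty reversal.empty)
  next
    case succ
    have iff: "\<mu> < \<xi> \<longleftrightarrow> \<mu> < \<eta> \<or> \<mu> = \<eta>" for \<mu>
      using succ by (meson less_trans not_less_iff_gr_or_eq)
    then have set: "{..<\<xi>} = insert \<eta> {..<\<eta>}"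
      by auto
    have "\<eta> \<in> {..<l}"
      using succ(1) less.prems by auto
    then have "c \<eta> \<in> directed_cycles (oriented D c {j \<in> {..<l}. j < \<eta>})"
      using assms unfolding admissible_def by blast
    also have "{j \<in> {..<l}. j < \<eta>} = {..<\<eta>}"
      using succ(1) less.prems by auto
    finally have cyc: "c \<eta> \<in> directed_cycles (oriented D c {..<\<eta>})" .
    have "reversal D ((\<lambda>\<mu>. if \<mu> < \<eta> then Some (c \<mu>) else None)(\<eta> \<mapsto> c \<eta>))
       (reverse_cycle (oriented D c {..<\<eta>}) (c \<eta>))"
    proof (rule reversal.snoc[OF less.IH _ cyc])
      show "dom (\<lambda>\<mu>. if \<mu> < \<eta> then Some (c \<mu>) else None) = {..<\<eta>}"
        by (auto split: if_splits)
    qed (use succ(1) less.prems in auto)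
    moreover have "(\<lambda>\<mu>. if \<mu> < \<eta> then Some (c \<mu>) else None)(\<eta> \<mapsto> c \<eta>) =
       (\<lambda>\<mu>. if \<mu> < \<xi> then Some (c \<mu>) else None)"
      by (rule ext) (simp add: iff)
    moreover have "oriented D c {..<\<xi>} = reverse_cycle (oriented D c {..<\<eta>}) (c \<eta>)"
      unfolding set by (rule oriented_insert_above) auto
    ultimately show ?thesis
      by simp
  next
    case limit
    have "oriented D c {..<\<xi>} = D\<lparr>parcs := {(u, v).
        \<exists>\<nu><\<xi>. \<forall>\<mu>. \<nu> < \<mu> \<and> \<mu> < \<xi> \<longrightarrow> (u, v) \<in> parcs (oriented D c {..<\<mu>})}\<rparr>"
    proof (rule oriented_eqI)
      fix u v
      \<comment> \<open>Beyond \<beta> no cycle before \<xi> meets the edge, so from there on its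
        orientation is the one given by the whole family.\<close>
      obtain \<beta> where \<beta>: "\<beta> < \<xi>" "\<forall>\<eta>. \<eta> < \<xi> \<and> ((u, v) \<in> c \<eta> \<or> (v, u) \<in> c \<eta>) \<longrightarrow> \<eta> < \<beta>"
        using finite_bounded_below_limit[OF limit fin[of u v]] by auto
      have eq: "(u, v) \<in> parcs (oriented D c {..<\<mu>}) \<longleftrightarrow> (u, v) \<in> parcs (oriented D c {..<\<xi>})"
        if "\<beta> < \<mu>" "\<mu> < \<xi>" for \<mu>
        using that \<beta>(2) by (intro oriented_superset) (auto dest: less_trans)
      have ex: "\<exists>\<mu>. \<beta> < \<mu> \<and> \<nu> < \<mu> \<and> \<mu> < \<xi>" if "\<nu> < \<xi>" for \<nu>
        using limit that \<beta>(1) unfolding limit_ordinal_def by (metis max_less_iff_conj)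
      show "((u, v) \<in> parcs (oriented D c {..<\<xi>})) =
        ((u, v) \<in> parcs (D\<lparr>parcs := {(u, v).
        \<exists>\<nu><\<xi>. \<forall>\<mu>. \<nu> < \<mu> \<and> \<mu> < \<xi> \<longrightarrow> (u, v) \<in> parcs (oriented D c {..<\<mu>})}\<rparr>))"
        using eq ex \<beta>(1) by simp metis
    qed simp
    moreover have "reversal D (\<lambda>\<eta>. if \<eta> < \<xi> then Some (c \<eta>) else None) \<dots>"
    proof (rule reversal.limit[OF limit, where \<S> = "\<lambda>\<mu> \<eta>. if \<eta> < \<mu> then Some (c \<eta>) else None"])
      show "reversal D (\<lambda>\<eta>. if \<eta> < \<mu> then Some (c \<eta>) else None) (oriented D c {..<\<mu>})"
        if "\<mu> < \<xi>" for \<mu>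
        using that less.prems by (intro less.IH) auto
      show "Map.graph (\<lambda>\<eta>. if \<eta> < \<xi> then Some (c \<eta>) else None) =
        (\<Union>\<mu>\<in>{..<\<xi>}. Map.graph (\<lambda>\<eta>. if \<eta> < \<mu> then Some (c \<eta>) else None))"
        using limit by (fastforce simp: Map.graph_def limit_ordinal_def split: if_splits dest: less_trans)
      show "locally_finite (\<lambda>\<eta>. if \<eta> < \<xi> then Some (c \<eta>) else None)"
        unfolding locally_finite_def positions_through_def
        by (intro allI finite_subset[OF _ fin]) (auto split: if_splits)
    qed (auto simp: map_le_def dom_def split: if_splits dest: less_trans)
    ultimately show ?thesis
      by simp
  qed
qed

lemma cycle_reachable_reversal:
  assumes "cycle_reachable D E"
  shows "\<exists>\<C>. reversal D \<C> E"
  using assms reversal_if_admissible unfolding cycle_reachable_def by blast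

section \<open>Re-indexing and concatenation of families of cycles\<close>

lemma oriented_image:
  assumes "bij_betw f J K" "\<And>x y. x \<in> J \<Longrightarrow> y \<in> J \<Longrightarrow> x < y \<longleftrightarrow> f x < f y"
    "\<And>x. x \<in> J \<Longrightarrow> c' (f x) = c x"
  shows "oriented D c' K = oriented D c J"
proof -
  have K: "K = f ` J"
    using assms(1) by (simp add: bij_betw_def)
  show ?thesis
    unfolding oriented_def K using assms(2,3) by simp
qed

text \<open>The family is transported along the order isomorphism of \<open>I\<close> with an
  initial segment of the ordinals. Lexicographically ordered pairs thereby become legitimate
  indices.\<close>

lemma cycle_reachable_if_admissible:
  fixes D :: "'a pair_pre_digraph" and c :: "'i :: wellorder \<Rightarrow> 'a rel"
  assumes "admissible D c I" "|I| \<le>o |UNIV :: ('a + nat) set|"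
  shows "cycle_reachable D (oriented D c I)"
proof -
  define r where "r = {(x, y). x \<in> I \<and> y \<in> I \<and> x \<le> y}"
  have F: "Field r = I"
    by (auto simp: r_def Field_def)
  have "wf {(x :: 'i, y). x < y}"
    by (rule wf)
  then have "wf (r - Id)"
    by (rule wf_subset) (auto simp: r_def)
  then have "Well_order r"
    unfolding well_order_on_def linear_order_on_def partial_order_on_def preorder_on_def F
    by (auto simp: r_def refl_on_def trans_def antisym_def total_on_def)
  from ordinal_enumeration[OF this, unfolded F, OF assms(2)]
  obtain f :: "'i \<Rightarrow> 'a ordinal" and l where f: "bij_betw f I {..<l}"
    and fr: "\<And>x y. x \<in> I \<Longrightarrow> y \<in> I \<Longrightarrow> (x, y) \<in> r \<longleftrightarrow> f x \<le> f y"
    by blast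
  have ord: "x \<le> y \<longleftrightarrow> f x \<le> f y" if "x \<in> I" "y \<in> I" for x y
    using fr[OF that] that by (simp add: r_def)
  have ord': "x < y \<longleftrightarrow> f x < f y" if "x \<in> I" "y \<in> I" for x y
    using ord[OF that] ord[of y x] that by auto
  define g where "g = inv_into I f"
  have gf: "g (f x) = x" if "x \<in> I" for x
    using f that by (simp add: g_def bij_betw_def)
  \<comment> \<open>Since \<open>f\<close> is onto \<open>{..<l}\<close>, the predecessors of
    \<open>f i\<close> are exactly the images of those of \<open>i\<close>; hence the digraph before
    each step survives the re-indexing.\<close>
  have initial: "oriented D (c \<circ> g) {..<f i} = oriented D c {j \<in> I. j < i}" if "i \<in> I" for i
  proof (rule oriented_image)
    have "f i < l" "f ` I = {..<l}"
      using f that by (auto simp: bij_betw_def)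
    then have "{..<f i} \<subseteq> f ` I"
      by auto
    moreover have "f j \<in> {..<f i} \<longleftrightarrow> j \<in> {j \<in> I. j < i}" if "j \<in> I" for j
      using ord'[OF that \<open>i \<in> I\<close>] that by simp
    ultimately have "f ` {j \<in> I. j < i} = {..<f i}"
      by blast
    then show "bij_betw f {j \<in> I. j < i} {..<f i}"
      using f by (auto simp: bij_betw_def inj_on_def)
  qed (use ord' gf in auto)
  have "admissible D (c \<circ> g) {..<l}"
    unfolding admissible_def
  proof (intro conjI ballI allI)
    fix \<xi> assume "\<xi> \<in> {..<l}"
    then obtain i where i: "i \<in> I" "\<xi> = f i"
      using f by (auto simp: bij_betw_def)
    have "{j \<in> {..<l}. j < \<xi>} = {..<\<xi>}"
      using \<open>\<xi> \<in> {..<l}\<close> by auto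
    then show "(c \<circ> g) \<xi> \<in> directed_cycles (oriented D (c \<circ> g) {j \<in> {..<l}. j < \<xi>})"
      using assms(1) i initial gf by (simp add: admissible_def)
  next
    fix u v
    have "{\<xi> \<in> {..<l}. (u, v) \<in> (c \<circ> g) \<xi> \<or> (v, u) \<in> (c \<circ> g) \<xi>} \<subseteq>
      f ` {i \<in> I. (u, v) \<in> c i \<or> (v, u) \<in> c i}"
    proof
      fix \<xi> assume \<xi>: "\<xi> \<in> {\<xi> \<in> {..<l}. (u, v) \<in> (c \<circ> g) \<xi> \<or> (v, u) \<in> (c \<circ> g) \<xi>}"
      then obtain i where "i \<in> I" "\<xi> = f i"
        using f unfolding bij_betw_def by blast
      with \<xi> show "\<xi> \<in> f ` {i \<in> I. (u, v) \<in> c i \<or> (v, u) \<in> c i}"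
        by (auto simp: gf)
    qed
    then show "finite {\<xi> \<in> {..<l}. (u, v) \<in> (c \<circ> g) \<xi> \<or> (v, u) \<in> (c \<circ> g) \<xi>}"
      using assms(1) by (elim finite_subset) (simp add: admissible_def)
  qed
  moreover have "oriented D (c \<circ> g) {..<l} = oriented D c I"
    using f ord' gf by (intro oriented_image) auto
  ultimately show ?thesis
    unfolding cycle_reachable_def by metis
qed

lemma cycle_reachable_refl: "cycle_reachable D D"
proof -
  have "admissible D (\<lambda>_ :: nat. {}) {}"
    by (simp add: admissible_def)
  then show ?thesis
    using cycle_reachable_if_admissible[of D "\<lambda>_ :: nat. {}" "{}"] by (simp add: card_of_empty)
qed

text \<open>The two sequences are concatenated by tagging their indices with \<open>0\<close> and
  \<open>Suc 0\<close> in the lexicographic order.\<close>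

lemma cycle_reachable_trans:
  fixes D :: "'a pair_pre_digraph"
  assumes "cycle_reachable D E" "cycle_reachable E E'"
  shows "cycle_reachable D E'"
proof -
  obtain c1 c2 and l1 l2 :: "'a ordinal"
    where 1: "admissible D c1 {..<l1}" "E = oriented D c1 {..<l1}"
      and 2: "admissible E c2 {..<l2}" "E' = oriented E c2 {..<l2}"
    using assms unfolding cycle_reachable_def by blast
  define c where "c = (\<lambda>(n :: nat, \<xi>). if n = 0 then c1 \<xi> else c2 \<xi>)"
  define J where "J = (\<lambda>A B. Pair (0 :: nat) ` A \<union> Pair (Suc 0) ` B :: (nat \<times> 'a ordinal) set)"
  have c [simp]: "c (0, \<xi>) = c1 \<xi>" "c (Suc 0, \<xi>) = c2 \<xi>" for \<xi>
    by (simp_all add: c_def)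
  have bex: "(\<exists>x\<in>J A B. P x) \<longleftrightarrow> (\<exists>\<xi>\<in>A. P (0, \<xi>)) \<or> (\<exists>\<xi>\<in>B. P (Suc 0, \<xi>))" 
   and ball: "(\<forall>x\<in>J A B. P x) \<longleftrightarrow> (\<forall>\<xi>\<in>A. P (0, \<xi>)) \<and> (\<forall>\<xi>\<in>B. P (Suc 0, \<xi>))" for A B P
    by (auto simp: J_def)
  have first: "oriented D c (J A {}) = oriented D c1 A" for A
    unfolding oriented_def bex ball by simp
  \<comment> \<open>Indices tagged \<open>Suc 0\<close> lie above all those tagged \<open>0\<close>,
    so the first family decides only edges that the second does not meet.\<close>
  have both: "oriented D c (J A B) = oriented (oriented D c1 A) c2 B" for A B
    by (rule oriented_eqI) (auto simp: parcs_oriented bex ball)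
  have "admissible D c (J {..<l1} {..<l2})"
    unfolding admissible_def ball
  proof (intro conjI ballI allI)
    fix \<xi> assume \<xi>: "\<xi> \<in> {..<l1}"
    have "{j \<in> J {..<l1} {..<l2}. j < (0, \<xi>)} = J {j \<in> {..<l1}. j < \<xi>} {}"
      by (auto simp: J_def)
    then show "c (0, \<xi>) \<in> directed_cycles (oriented D c {j \<in> J {..<l1} {..<l2}. j < (0, \<xi>)})"
      using 1(1) \<xi> by (simp add: first admissible_def)
  next
    fix \<xi> assume \<xi>: "\<xi> \<in> {..<l2}"
    have "{j \<in> J {..<l1} {..<l2}. j < (Suc 0, \<xi>)} = J {..<l1} {j \<in> {..<l2}. j < \<xi>}"
      by (auto simp: J_def)
    then show "c (Suc 0, \<xi>) \<in> directed_cycles (oriented D c {j \<in> J {..<l1} {..<l2}. j < (Suc 0, \<xi>)})"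
      using 2(1) \<xi> by (simp add: both admissible_def flip: 1(2))
  next
    fix u v
    have "{i \<in> J {..<l1} {..<l2}. (u, v) \<in> c i \<or> (v, u) \<in> c i} =
      J {i \<in> {..<l1}. (u, v) \<in> c1 i \<or> (v, u) \<in> c1 i} {i \<in> {..<l2}. (u, v) \<in> c2 i \<or> (v, u) \<in> c2 i}"
      by (auto simp: J_def c_def)
    then show "finite {i \<in> J {..<l1} {..<l2}. (u, v) \<in> c i \<or> (v, u) \<in> c i}"
      using 1(1) 2(1) by (simp add: admissible_def J_def)
  qed
  moreover have "|J {..<l1} {..<l2}| \<le>o |UNIV :: ('a + nat) set|"
    unfolding J_def
    by (intro card_of_Un_ordLeq_infinite_Field ordLeq_transitive[OF card_of_image card_of_lessThan_ordinal])
      (simp_all add: Field_card_of card_of_card_order_on)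
  ultimately show ?thesis
    using cycle_reachable_if_admissible[of D c "J {..<l1} {..<l2}"] unfolding 1(2) 2(2) both by blast
qed

section \<open>Balanced arc sets\<close>

text \<open>For finite \<open>M\<close> this is the net outflow at \<open>v\<close>; a finite arc
  set is balanced (Eulerian) if it vanishes everywhere. Integers make the subtraction exact.\<close>

definition excess :: "'a rel \<Rightarrow> 'a \<Rightarrow> int" where
  "excess M v = int (card {e \<in> M. fst e = v}) - int (card {e \<in> M. snd e = v})"

lemma excess_Un_disjoint:
  assumes "finite A" "finite B" "A \<inter> B = {}"
  shows "excess (A \<union> B) v = excess A v + excess B v"
proof -
  have "card {e \<in> A \<union> B. P e} = card {e \<in> A. P e} + card {e \<in> B. P e}" for P
  proof -
    have "{e \<in> A \<union> B. P e} = {e \<in> A. P e} \<union> {e \<in> B. P e}"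
      by auto
    then show ?thesis
      using assms by (auto intro!: card_Un_disjoint)
  qed
  then show ?thesis
    by (simp add: excess_def)
qed

lemma excess_converse: "excess (M\<inverse>) v = - excess M v"
proof -
  have "{e \<in> M\<inverse>. fst e = v} = prod.swap ` {e \<in> M. snd e = v}"
    "{e \<in> M\<inverse>. snd e = v} = prod.swap ` {e \<in> M. fst e = v}"
    by (auto simp: image_iff)
  then show ?thesis
    by (simp add: excess_def card_image)
qed

text \<open>Each arc contributes 1 at its tail and -1 at its head, and consecutive contributions
  cancel. Distinctness matters because \<open>set p\<close> forgets multiplicities.\<close>

lemma excess_walk:
  assumes "pcas u p v" "distinct p"
  shows "excess (set p) x = of_bool (x = u) - of_bool (x = v)"
  using assms
proof (induction p arbitrary: u)
  case Nil
  then show ?case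
    by (simp add: excess_def)
next
  case (Cons e p)
  have "{e' \<in> {e}. P e'} = (if P e then {e} else {})" for P
    by auto
  then have "excess {e} x = of_bool (x = fst e) - of_bool (x = snd e)"
    by (auto simp: excess_def)
  moreover have "excess (set (e # p)) x = excess {e} x + excess (set p) x"
    using Cons.prems(2) excess_Un_disjoint[of "{e}" "set p" x] by simp
  ultimately show ?case
    using Cons.IH[of "snd e"] Cons.prems by auto
qed

lemma directed_cycles_mono:
  assumes "C \<in> directed_cycles G" "C \<subseteq> parcs H" "pverts G \<subseteq> pverts H"
  shows "C \<in> directed_cycles H"
  using assms
  by (auto simp: directed_cycles_def pre_digraph.cycle_def pre_digraph.awalk_def
      cas_with_proj_eq awalk_verts_with_proj_eq)

lemma directed_cycleD:
  assumes "C \<in> directed_cycles G" "pair_wf_digraph G"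
  shows "C \<noteq> {}" "C \<subseteq> parcs G" "finite C" "excess C v = 0"
proof -
  interpret pair_wf_digraph G by fact
  obtain p where "cycle p" and C: "C = set p"
    using assms(1) by (auto simp: directed_cycles_def)
  then obtain u where "awalk u p u" "distinct p" "p \<noteq> []"
    by (auto simp: cycle_conv)
  then show "C \<noteq> {}" "C \<subseteq> parcs G" "finite C" "excess C v = 0"
    using excess_walk[of u p u v] by (auto simp: C awalk_def)
qed

text \<open>In a finite nonempty acyclic arc set some head has no outgoing arc, which contradicts
  balance there. So \<open>M\<close> contains a closed walk, and this contains a cycle.\<close>

lemma balanced_contains_cycle:
  assumes "pair_wf_digraph G" "finite M" "M \<noteq> {}" "M \<subseteq> parcs G" "\<And>v. excess M v = 0"
  shows "\<exists>C \<in> directed_cycles G. C \<subseteq> M"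
proof -
  have "\<not> acyclic M"
  proof
    assume "acyclic M"
    then have "wf (M\<inverse>)"
      using assms(2) by (simp add: finite_acyclic_wf_converse)
    moreover have "Range M \<noteq> {}"
      using assms(3) by auto
    ultimately obtain z where z: "z \<in> Range M" "\<And>y. (y, z) \<in> M\<inverse> \<Longrightarrow> y \<notin> Range M"
      by (metis wfE_min ex_in_conv)
    have "{e \<in> M. fst e = z} = {}"
      using z(2) by auto
    then have "card {e \<in> M. snd e = z} = 0"
      using assms(5)[of z] by (simp only: excess_def) simp
    then show False
      using z(1) assms(2) by (auto simp: card_eq_0_iff)
  qed
  then obtain x where x: "(x, x) \<in> M\<^sup>+"
    by (auto simp: acyclic_def)
  let ?H = "\<lparr>pverts = pverts G, parcs = M\<rparr>"
  interpret H: pair_wf_digraph ?H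
    using assms(1,4) by unfold_locales (force simp: pair_wf_digraph_def)+
  have "x \<rightarrow>\<^sup>+\<^bsub>?H\<^esub> x"
    using x by simp
  then have "\<exists>p. H.cycle p"
    using H.reachable1_awalk[of x x] H.closed_w_imp_cycle by (auto simp: H.closed_w_def)
  then obtain p where p: "H.cycle p"
    by blast
  then have sub: "set p \<subseteq> M"
    by (auto simp: H.cycle_def H.awalk_def)
  have "set p \<in> directed_cycles ?H"
    using p by (auto simp: directed_cycles_def)
  then have "set p \<in> directed_cycles G"
    by (rule directed_cycles_mono) (use sub assms(4) in auto)
  with sub show ?thesis
    by blast
qed

text \<open>Removing a cycle leaves a smaller balanced set. The result is a list because its cycles
  are to be reversed one after the other.\<close>

lemma balanced_cycle_decomposition:
  assumes "pair_wf_digraph G" "finite M" "M \<subseteq> parcs G" "\<And>v. excess M v = 0"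
  shows "\<exists>Cs. set Cs \<subseteq> directed_cycles G \<and> \<Union> (set Cs) = M \<and> sorted_wrt disjnt Cs"
  using assms(2-)
proof (induction M rule: finite_psubset_induct)
  case (psubset M)
  show ?case
  proof (cases "M = {}")
    case True
    then show ?thesis
      by (intro exI[of _ "[]"]) auto
  next
    case False
    then obtain C where C: "C \<in> directed_cycles G" "C \<subseteq> M"
      using balanced_contains_cycle[OF assms(1) psubset.hyps] psubset.prems by blast
    note CD = directed_cycleD[OF C(1) assms(1)]
    have "excess (M - C) v = 0" for v
    proof -
      have "excess (C \<union> (M - C)) v = excess C v + excess (M - C) v"
        using psubset.hyps CD(3) by (intro excess_Un_disjoint) auto
      then show ?thesis
        using CD(4)[of v] psubset.prems(2) C(2) by (simp add: Un_absorb1)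
    qed
    moreover have "M - C \<subset> M"
      using C(2) CD(1) by auto
    ultimately obtain Cs where Cs: "set Cs \<subseteq> directed_cycles G" "\<Union> (set Cs) = M - C" "sorted_wrt disjnt Cs"
      using psubset.IH[of "M - C"] psubset.prems(1) by auto
    then have "set (C # Cs) \<subseteq> directed_cycles G \<and> \<Union> (set (C # Cs)) = M \<and> sorted_wrt disjnt (C # Cs)"
      using C by (auto simp: disjnt_def)
    then show ?thesis
      by blast
  qed
qed

section \<open>Realising balanced changes by reversal sequences\<close>

lemma oriented_last:
  fixes c :: "'i :: linorder \<Rightarrow> 'a rel"
  assumes "j \<in> J" "(u, v) \<in> c j \<or> (v, u) \<in> c j"
    "\<And>k. k \<in> J \<Longrightarrow> j < k \<Longrightarrow> (u, v) \<notin> c k \<and> (v, u) \<notin> c k"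
  shows "(u, v) \<in> parcs (oriented D c J) \<longleftrightarrow> (v, u) \<in> c j"
proof -
  have "k = j" if "k \<in> J" "(v, u) \<in> c k" "\<forall>l\<in>J. k < l \<longrightarrow> (u, v) \<notin> c l \<and> (v, u) \<notin> c l" for k
    using assms that by (metis linorder_cases)
  then show ?thesis
    unfolding parcs_oriented using assms by blast
qed

lemma pair_wf_digraph_reverse_cycle:
  assumes "pair_wf_digraph D" "F \<subseteq> parcs D"
  shows "pair_wf_digraph (reverse_cycle D F)"
  using assms by (fastforce simp: pair_wf_digraph_def reverse_cycle_def)

text \<open>
  \<open>F p\<close> and \<open>F' p\<close> are the sets of arcs of \<open>D\<close> that are reversed before and after step \<open>p\<close>, and \<open>L\<close> is
  the set of those that are reversed in the end.
\<close>

lemma cycle_reachable_flips: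
  fixes D :: "'a pair_pre_digraph" and P :: "'p :: wellorder set"
  assumes wf: "pair_wf_digraph D" and anti: "\<And>u v. (u, v) \<in> parcs D \<Longrightarrow> (v, u) \<notin> parcs D"
    and card: "|P| \<le>o |UNIV :: ('a + nat) set|"
    and sub: "\<And>p. p \<in> P \<Longrightarrow> F p \<subseteq> parcs D \<and> F' p \<subseteq> parcs D" "L \<subseteq> parcs D"
    and fin: "\<And>p. p \<in> P \<Longrightarrow> finite (sym_diff (F p) (F' p))"
    and bal: "\<And>p v. p \<in> P \<Longrightarrow> excess (F' p - F p) v = excess (F p - F' p) v"
    and locfin: "\<And>e. finite {p \<in> P. e \<in> sym_diff (F p) (F' p)}"
    and init: "\<And>p e. p \<in> P \<Longrightarrow> e \<in> F p \<Longrightarrow> \<exists>q\<in>P. q < p \<and> e \<in> sym_diff (F q) (F' q)"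
    and coherent: "\<And>p q e. p \<in> P \<Longrightarrow> q \<in> P \<Longrightarrow> q < p \<Longrightarrow>
      (\<And>r. r \<in> P \<Longrightarrow> q < r \<Longrightarrow> r < p \<Longrightarrow> e \<notin> sym_diff (F r) (F' r)) \<Longrightarrow> e \<in> F' q \<longleftrightarrow> e \<in> F p"
    and init_L: "\<And>e. e \<in> L \<Longrightarrow> \<exists>q\<in>P. e \<in> sym_diff (F q) (F' q)"
    and coherent_L: "\<And>q e. q \<in> P \<Longrightarrow>
      (\<And>r. r \<in> P \<Longrightarrow> q < r \<Longrightarrow> e \<notin> sym_diff (F r) (F' r)) \<Longrightarrow> e \<in> F' q \<longleftrightarrow> e \<in> L"
  shows "cycle_reachable D (reverse_cycle D L)"
proof -
  \<comment> \<open>These are arcs of the digraph present before step \<open>p\<close>: arcs still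
    to be reversed appear as in \<open>D\<close>, arcs to be restored appear in their reversed form.
    By \<open>bal\<close> the set is balanced, so it splits into directed cycles of that
    digraph.\<close>
  define M where "M p = (F' p - F p) \<union> (F p - F' p)\<inverse>" for p
  have M_parcs: "M p \<subseteq> parcs (reverse_cycle D (F p))" if "p \<in> P" for p
    using sub(1)[OF that] anti by (auto simp: M_def reverse_cycle_def)
  have "\<exists>Cs. set Cs \<subseteq> directed_cycles (reverse_cycle D (F p)) \<and> \<Union> (set Cs) = M p \<and> sorted_wrt disjnt Cs"
    if "p \<in> P" for p
  proof (rule balanced_cycle_decomposition)
    show "pair_wf_digraph (reverse_cycle D (F p))"
      using pair_wf_digraph_reverse_cycle wf sub(1)[OF that] by blast
    show "finite (M p)"
      using fin[OF that] by (simp add: M_def)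
    have "(F' p - F p) \<inter> (F p - F' p)\<inverse> = {}"
      using sub(1)[OF that] anti by blast
    then show "excess (M p) v = 0" for v
      using bal[OF that, of v] fin[OF that]
      by (simp add: M_def excess_Un_disjoint excess_converse)
  qed (use M_parcs[OF that] in blast)
  then obtain Cs where Cs: "\<And>p. p \<in> P \<Longrightarrow> set (Cs p) \<subseteq> directed_cycles (reverse_cycle D (F p))"
      "\<And>p. p \<in> P \<Longrightarrow> \<Union> (set (Cs p)) = M p" "\<And>p. p \<in> P \<Longrightarrow> sorted_wrt disjnt (Cs p)"
    by metis
  \<comment> \<open>In the lexicographic order the cycles of one step follow each other, and the
    steps follow the order of \<open>P\<close>.\<close>
  define c where "c = (\<lambda>(p, k). Cs p ! k)"
  define I where "I = {(p, k). p \<in> P \<and> k < length (Cs p)}"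
  have c_in_M: "e \<in> c (p, k) \<Longrightarrow> e \<in> M p" if "(p, k) \<in> I" for p k e
    using that Cs(2)[of p] by (auto simp: I_def c_def)
  have M_in_c: "\<exists>k. (p, k) \<in> I \<and> e \<in> c (p, k)" if "p \<in> P" "e \<in> M p" for p e
  proof -
    have "e \<in> \<Union> (set (Cs p))"
      using that Cs(2) by simp
    then show ?thesis
      using that(1) by (auto simp: I_def c_def in_set_conv_nth)
  qed
  have disj: "c (p, k) \<inter> c (p, k') = {}" if "(p, k) \<in> I" "(p, k') \<in> I" "k < k'" for p k k'
    using that Cs(3)[of p] by (auto simp: I_def c_def sorted_wrt_iff_nth_less disjnt_def)
  have M_iff: "(u, v) \<in> M p \<longleftrightarrow> (u, v) \<in> F' p - F p" "(v, u) \<in> M p \<longleftrightarrow> (u, v) \<in> F p - F' p"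
    if "(u, v) \<in> parcs D" "p \<in> P" for u v p
    using sub(1)[OF that(2)] anti[OF that(1)] by (auto simp: M_def)

  \<comment> \<open>Orientations only depend on the last change, so coherence identifies them with \<open>X\<close>.\<close>
  have state: "oriented D c {j \<in> I. fst j \<in> Q} = reverse_cycle D X"
    if X: "X \<subseteq> parcs D" and Q: "Q \<subseteq> P"
      and iX: "\<And>e. e \<in> X \<Longrightarrow> \<exists>q\<in>Q. e \<in> sym_diff (F q) (F' q)"
      and cX: "\<And>q e. q \<in> Q \<Longrightarrow> (\<And>r. r \<in> Q \<Longrightarrow> q < r \<Longrightarrow> e \<notin> sym_diff (F r) (F' r)) \<Longrightarrow>
        e \<in> F' q \<longleftrightarrow> e \<in> X" for Q X
  proof -
    let ?J = "{j \<in> I. fst j \<in> Q}"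
    have main: "((u, v) \<in> parcs (oriented D c ?J) \<longleftrightarrow> (u, v) \<notin> X) \<and>
        ((v, u) \<in> parcs (oriented D c ?J) \<longleftrightarrow> (u, v) \<in> X)" if e: "(u, v) \<in> parcs D" for u v
    proof (cases "\<exists>q\<in>Q. (u, v) \<in> sym_diff (F q) (F' q)")
      case False
      then have "(u, v) \<notin> c j \<and> (v, u) \<notin> c j" if "j \<in> ?J" for j
        using that c_in_M[of "fst j" "snd j"] M_iff[OF e, of "fst j"] Q by auto
      moreover have "(u, v) \<notin> X"
        using False iX by blast
      ultimately show ?thesis
        using e anti by (auto simp: parcs_oriented)
    next
      case True
      let ?S = "{q \<in> Q. (u, v) \<in> sym_diff (F q) (F' q)}"
      have S: "finite ?S" "?S \<noteq> {}"
        using True Q by (auto intro: finite_subset[OF _ locfin[of "(u, v)"]])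
      \<comment> \<open>The last step in \<open>Q\<close> that changes the edge, which exists by
        \<open>locfin\<close>; by \<open>cX\<close> it determines membership in
        \<open>X\<close>.\<close>
      define q where "q = Max ?S"
      have q: "q \<in> ?S" and q_max: "\<And>r. r \<in> ?S \<Longrightarrow> r \<le> q"
        using Max_in[OF S] Max_ge[OF S(1)] unfolding q_def by blast+
      have qP: "q \<in> P"
        using q Q by auto
      have X_iff: "(u, v) \<in> F' q \<longleftrightarrow> (u, v) \<in> X"
        using q q_max by (intro cX) (auto simp: not_le[symmetric])
      have "(u, v) \<in> M q \<or> (v, u) \<in> M q"
        using q M_iff[OF e qP] by auto
      then obtain k where k: "(q, k) \<in> I" "(u, v) \<in> c (q, k) \<or> (v, u) \<in> c (q, k)"
        using M_in_c[OF qP] by blast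
      have not_both: "\<not> ((u, v) \<in> M q \<and> (v, u) \<in> M q)"
        using M_iff[OF e qP] by auto
      \<comment> \<open>A later cycle either belongs to step \<open>q\<close> and is disjoint from
        the \<open>k\<close>-th one, or belongs to a later step, which by maximality of
        \<open>q\<close> does not change the edge.\<close>
      have later: "(u, v) \<notin> c j \<and> (v, u) \<notin> c j" if j: "j \<in> ?J" "(q, k) < j" for j
      proof -
        obtain r k' where [simp]: "j = (r, k')"
          by (cases j)
        have rk: "(r, k') \<in> I" "r \<in> Q" "r \<in> P"
          using j Q by auto
        show ?thesis
        proof (cases "r = q")
          case True
          then have "c (q, k) \<inter> c (r, k') = {}"
            using disj[of q k k'] k(1) rk j(2) by auto
          then show ?thesis
            using k not_both True c_in_M[OF k(1)] c_in_M[OF rk(1)] by auto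
        next
          case False
          then have "q < r"
            using j(2) by auto
          then have "r \<notin> ?S"
            using q_max[of r] by (meson not_le)
          then show ?thesis
            using c_in_M[OF rk(1)] M_iff[OF e rk(3)] rk(2) by auto
        qed
      qed
      have "(u, v) \<in> parcs (oriented D c ?J) \<longleftrightarrow> (v, u) \<in> c (q, k)"
        using k q later by (intro oriented_last) auto
      moreover have "(v, u) \<in> parcs (oriented D c ?J) \<longleftrightarrow> (u, v) \<in> c (q, k)"
        using k q later by (intro oriented_last) auto
      moreover have "(u, v) \<in> c (q, k) \<longleftrightarrow> (u, v) \<in> X" "(v, u) \<in> c (q, k) \<longleftrightarrow> (u, v) \<notin> X"
        using X_iff k(2) not_both c_in_M[OF k(1)] M_iff[OF e qP] by blast+
      ultimately show ?thesis
        by blast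
    qed
    show ?thesis
    proof (rule oriented_eqI)
      fix u v
      consider "(u, v) \<in> parcs D" | "(v, u) \<in> parcs D" | "(u, v) \<notin> parcs D" "(v, u) \<notin> parcs D"
        by blast
      then show "(u, v) \<in> parcs (oriented D c ?J) \<longleftrightarrow> (u, v) \<in> parcs (reverse_cycle D X)"
      proof cases
        case 3
        then have "(v, u) \<notin> c j" if "j \<in> ?J" for j
          using that c_in_M[of "fst j" "snd j"] sub(1)[of "fst j"] Q by (auto simp: M_def)
        then show ?thesis
          using 3 X by (auto simp: reverse_cycle_def parcs_oriented)
      qed (use main X anti in \<open>auto simp: reverse_cycle_def\<close>)
    qed (simp add: reverse_cycle_def)
  qed
  \<comment> \<open>The first \<open>k\<close> reversals of step \<open>p\<close> destroy only arcs
    of the cycles reversed. The next cycle is disjoint from these, hence still present when its turn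
    comes.\<close>
  have kth: "parcs (reverse_cycle D (F p)) - (\<Union>i<k. Cs p ! i) \<subseteq> parcs (oriented D c {j \<in> I. j < (p, k)})"
    if "p \<in> P" "k \<le> length (Cs p)" for p k
    using that(2)
  proof (induction k)
    case 0
    have "{j \<in> I. j < (p, 0)} = {j \<in> I. fst j \<in> {q \<in> P. q < p}}"
      by (auto simp: I_def)
    moreover have "oriented D c {j \<in> I. fst j \<in> {q \<in> P. q < p}} = reverse_cycle D (F p)"
    proof (rule state)
      show "e \<in> F' q \<longleftrightarrow> e \<in> F p" if "q \<in> {q \<in> P. q < p}" 
        "\<And>r. r \<in> {q \<in> P. q < p} \<Longrightarrow> q < r \<Longrightarrow> e \<notin> sym_diff (F r) (F' r)" for q e
        using that \<open>p \<in> P\<close> by (intro coherent) auto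
      show "\<exists>q\<in>{q \<in> P. q < p}. e \<in> sym_diff (F q) (F' q)" if "e \<in> F p" for e
        using init[OF \<open>p \<in> P\<close> that] by auto
    qed (use sub(1)[OF \<open>p \<in> P\<close>] in auto)
    ultimately show ?case
      by simp
  next
    case (Suc k)
    have "{j \<in> I. j < (p, Suc k)} = insert (p, k) {j \<in> I. j < (p, k)}"
      using Suc.prems \<open>p \<in> P\<close> by (auto simp: I_def less_Suc_eq)
    then have "oriented D c {j \<in> I. j < (p, Suc k)} =
      reverse_cycle (oriented D c {j \<in> I. j < (p, k)}) (Cs p ! k)"
      using oriented_insert_above[of "{j \<in> I. j < (p, k)}" "(p, k)" D c] by (simp add: c_def)
    then show ?case
      using Suc by (auto simp: reverse_cycle_def lessThan_Suc)
  qed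
  have "admissible D c I"
    unfolding admissible_def
  proof (intro conjI ballI allI)
    fix j assume j: "j \<in> I"
    obtain p k where [simp]: "j = (p, k)"
      by (cases j)
    have pk: "p \<in> P" "k < length (Cs p)"
      using j by (auto simp: I_def)
    have "Cs p ! k \<inter> Cs p ! i = {}" if "i < k" for i
      using disj[of p i k] pk that by (auto simp: I_def c_def)
    moreover have "Cs p ! k \<subseteq> M p"
      using pk Cs(2)[OF pk(1)] by auto
    ultimately have "Cs p ! k \<subseteq> parcs (reverse_cycle D (F p)) - (\<Union>i<k. Cs p ! i)"
      using M_parcs[OF pk(1)] by blast
    also have "\<dots> \<subseteq> parcs (oriented D c {i \<in> I. i < j})"
      using kth[OF pk(1), of k] pk(2) by simp
    finally have "Cs p ! k \<subseteq> parcs (oriented D c {i \<in> I. i < j})" .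
    then show "c j \<in> directed_cycles (oriented D c {i \<in> I. i < j})"
      using Cs(1)[OF pk(1)] nth_mem[OF pk(2)]
      by (simp add: c_def) (rule directed_cycles_mono, auto simp: reverse_cycle_def)
  next
    fix u v
    \<comment> \<open>At most one cycle of each step contains \<open>e\<close>, so it suffices to
      count steps. Both \<open>e\<close> and its converse have to be considered, since restored arcs
      enter \<open>M p\<close> reversed.\<close>
    have "finite {j \<in> I. e \<in> c j}" for e
    proof -
      have "k = k'" if "(p, k) \<in> I" "(p, k') \<in> I" "e \<in> c (p, k)" "e \<in> c (p, k')" for p k k'
        using disj[of p k k'] disj[of p k' k] that by (metis disjoint_iff linorder_cases)
      then have inj: "inj_on fst {j \<in> I. e \<in> c j}"
        by (auto intro!: inj_onI)
      have "fst ` {j \<in> I. e \<in> c j} \<subseteq>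
        {p \<in> P. e \<in> sym_diff (F p) (F' p)} \<union> {p \<in> P. prod.swap e \<in> sym_diff (F p) (F' p)}"
      proof
        fix p assume "p \<in> fst ` {j \<in> I. e \<in> c j}"
        then obtain k where "(p, k) \<in> I" "e \<in> c (p, k)"
          by auto
        then have "p \<in> P" "e \<in> M p"
          using c_in_M[of p k e] by (auto simp: I_def)
        then show "p \<in> {p \<in> P. e \<in> sym_diff (F p) (F' p)} \<union>
            {p \<in> P. prod.swap e \<in> sym_diff (F p) (F' p)}"
          by (auto simp: M_def)
      qed
      then have "finite (fst ` {j \<in> I. e \<in> c j})"
        by (rule finite_subset[OF _ finite_UnI[OF locfin locfin]])
      then show ?thesis
        using inj by (rule finite_imageD)
    qed
    from this[of "(u, v)"] this[of "(v, u)"] have "finite ({j \<in> I. (u, v) \<in> c j} \<union> {j \<in> I. (v, u) \<in> c j})"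
      by blast
    then show "finite {j \<in> I. (u, v) \<in> c j \<or> (v, u) \<in> c j}"
      by (rule finite_subset[rotated]) auto
  qed
  moreover have "|I| \<le>o |UNIV :: ('a + nat) set|"
  proof -
    have "|I| \<le>o |P \<times> (UNIV :: nat set)|"
      by (rule card_of_mono1) (auto simp: I_def)
    also have "|P \<times> (UNIV :: nat set)| \<le>o |UNIV :: ('a + nat) set|"
    proof (rule card_of_Times_ordLeq_infinite_Field)
      show "|UNIV :: nat set| \<le>o |UNIV :: ('a + nat) set|"
        by (rule card_of_ordLeqI[of Inr]) auto
    qed (simp_all add: Field_card_of card_of_card_order_on card)
    finally show ?thesis .
  qed
  ultimately have "cycle_reachable D (oriented D c I)"
    by (rule cycle_reachable_if_admissible)
  moreover have "oriented D c {j \<in> I. fst j \<in> P} = reverse_cycle D L"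
    by (rule state[OF sub(2) subset_refl init_L coherent_L])
  moreover have "{j \<in> I. fst j \<in> P} = I"
    by (auto simp: I_def)
  ultimately show ?thesis
    by simp
qed

section \<open>Paths as arc sets and limits of sequences of arc sets\<close>

lemma simple_walk_single_valued:
  assumes "pcas u p v" "distinct (pawalk_verts u p)"
  shows "distinct p \<and> single_valued (set p) \<and> single_valued ((set p)\<inverse>) \<and> u \<notin> snd ` set p \<and>
    u \<in> set (pawalk_verts u p) \<and> fst ` set p \<union> snd ` set p \<subseteq> set (pawalk_verts u p)"
  using assms
proof (induction p arbitrary: u)
  case Nil
  then show ?case
    by simp
next
  case (Cons e p)
  have IH: "distinct p" "single_valued (set p)" "single_valued ((set p)\<inverse>)" "snd e \<notin> snd ` set p"
    "snd e \<in> set (pawalk_verts (snd e) p)"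
    "fst ` set p \<union> snd ` set p \<subseteq> set (pawalk_verts (snd e) p)"
    using Cons.IH[of "snd e"] Cons.prems by auto
  have u: "u = fst e" "fst e \<notin> set (pawalk_verts (snd e) p)"
    using Cons.prems by auto
  have new: "fst e \<notin> fst ` set p" "fst e \<notin> snd ` set p" "fst e \<noteq> snd e"
    using u(2) IH(5,6) by auto
  obtain x y where e: "e = (x, y)"
    by (cases e)
  have x: "(x, z) \<notin> set p" and y: "(z, y) \<notin> set p" for z
    using new(1) IH(4) by (force simp: e)+
  have "single_valued (set (e # p))"
    unfolding single_valued_def
  proof (intro allI impI)
    fix a b c assume "(a, b) \<in> set (e # p)" "(a, c) \<in> set (e # p)"
    then show "b = c"
      using x single_valuedD[OF IH(2), of a b c] by (auto simp: e)
  qed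
  moreover have "single_valued ((set (e # p))\<inverse>)"
    unfolding single_valued_def
  proof (intro allI impI)
    fix a b c assume "(a, b) \<in> (set (e # p))\<inverse>" "(a, c) \<in> (set (e # p))\<inverse>"
    then show "b = c"
      using y single_valuedD[OF IH(3), of a b c] by (auto simp: e)
  qed
  moreover have "distinct (e # p)"
    using x IH(1) by (simp add: e)
  ultimately show ?case
    using new u(1) IH(5,6) by auto
qed

text \<open>With \<open>R\<close> as arc set of a digraph on the whole type, a walk shortens to a
  path. Single-valuedness in both directions says that no vertex is left or entered twice; being a
  condition on pairs of arcs, it passes to pointwise limits.\<close>

lemma rtrancl_simple_walk:
  assumes "(x, y) \<in> R\<^sup>*"
  shows "\<exists>p. pcas x p y \<and> set p \<subseteq> R \<and> distinct p \<and> single_valued (set p) \<and>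
    single_valued ((set p)\<inverse>)"
proof -
  let ?H = "\<lparr>pverts = UNIV, parcs = R\<rparr>"
  interpret H: pair_wf_digraph ?H
    by unfold_locales auto
  have "\<exists>p. H.awalk x p y"
    using assms
  proof (induction rule: converse_rtrancl_induct)
    case base
    then show ?case
      by (intro exI[of _ "[]"]) (simp add: H.awalk_def)
  next
    case (step x z)
    then obtain p where "H.awalk z p y"
      by blast
    with step show ?case
      by (intro exI[of _ "(x, z) # p"]) (simp add: H.awalk_def)
  qed
  then obtain p where "H.apath x p y"
    using H.apath_awalk_to_apath by blast
  then have p: "pcas x p y" "set p \<subseteq> R" "distinct (pawalk_verts x p)"
    by (auto simp: H.apath_def H.awalk_def)
  then show ?thesis
    using simple_walk_single_valued[OF p(1,3)] by blast
qed

lemma pcas_append: "pcas u p v \<Longrightarrow> pcas v q w \<Longrightarrow> pcas u (p @ q) w"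
  by (induction p arbitrary: u) auto

text \<open>Diagonal argument: the union of the finite sets is countable, and for each of its
  elements a subsequence makes membership constant. Elements outside the union belong to no
  set.\<close>

lemma convergent_subsequence_sets:
  fixes F :: "nat \<Rightarrow> 'x set"
  assumes "\<And>n. finite (F n)"
  shows "\<exists>s :: nat \<Rightarrow> nat. strict_mono s \<and> (\<forall>e. \<exists>N. \<forall>n\<ge>N. e \<in> F (s n) \<longleftrightarrow> e \<in> F (s N))"
proof -
  define U where "U = (\<Union>n. F n)"
  have "countable U"
    unfolding U_def using assms by (auto intro: countable_finite)
  define Q where "Q k s \<longleftrightarrow> (\<exists>b N. \<forall>n\<ge>N. from_nat_into U k \<in> F (s n) \<longleftrightarrow> b)"
    for k and s :: "nat \<Rightarrow> nat"
  interpret subseqs Q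
  proof
    fix k and s :: "nat \<Rightarrow> nat" assume "strict_mono s"
    have eq: "{n. from_nat_into U k \<in> F (s n) \<longleftrightarrow> True} \<union>
        {n. from_nat_into U k \<in> F (s n) \<longleftrightarrow> False} = UNIV"
      by auto
    have "\<exists>b. infinite {n. from_nat_into U k \<in> F (s n) \<longleftrightarrow> b}"
    proof (rule ccontr)
      assume "\<nexists>b. infinite {n. from_nat_into U k \<in> F (s n) \<longleftrightarrow> b}"
      then have fin: "finite {n. from_nat_into U k \<in> F (s n) \<longleftrightarrow> b}" for b
        by blast
      show False
        using finite_UnI[OF fin[of True] fin[of False]] unfolding eq by simp
    qed
    then obtain b where b: "infinite {n. from_nat_into U k \<in> F (s n) \<longleftrightarrow> b}"
      by blast
    let ?S = "{n. from_nat_into U k \<in> F (s n) \<longleftrightarrow> b}"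
    have "from_nat_into U k \<in> F (s (enumerate ?S n)) \<longleftrightarrow> b" for n
      using enumerate_in_set[OF b] by (rule CollectD)
    then have "Q k (s \<circ> enumerate ?S)"
      unfolding Q_def comp_def by blast
    then show "\<exists>r. strict_mono r \<and> Q k (s \<circ> r)"
      using strict_mono_enumerate[OF b] by blast
  qed
  have stable: "Q k (s \<circ> r)" if "strict_mono r" "Q k s" for r s k
  proof -
    from that(2) obtain b N where N: "\<forall>n\<ge>N. from_nat_into U k \<in> F (s n) \<longleftrightarrow> b"
      by (auto simp: Q_def)
    have "n \<le> r n" for n
      using that(1) by (rule strict_mono_imp_increasing)
    then have "\<forall>n\<ge>N. from_nat_into U k \<in> F ((s \<circ> r) n) \<longleftrightarrow> b"
      using N order_trans by (metis comp_apply)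
    then show ?thesis
      by (auto simp: Q_def)
  qed
  have "\<exists>N. \<forall>n\<ge>N. e \<in> F (diagseq n) \<longleftrightarrow> e \<in> F (diagseq N)" for e
  proof (cases "e \<in> U")
    case True
    then obtain k where k: "from_nat_into U k = e"
      using \<open>countable U\<close> by (metis from_nat_into_surj)
    obtain b N where N: "\<forall>n\<ge>N. e \<in> F (diagseq (Suc k + n)) \<longleftrightarrow> b"
      using diagseq_holds[OF stable, of k] by (auto simp: Q_def k)
    have "e \<in> F (diagseq n) \<longleftrightarrow> b" if "n \<ge> Suc k + N" for n
      using N[rule_format, of "n - Suc k"] that by simp
    then show ?thesis
      by blast
  qed (auto simp: U_def)
  with subseq_diagseq show ?thesis
    by (intro exI[of _ diagseq] conjI allI)
qed

lemma unchanged_between: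
  fixes F :: "nat \<Rightarrow> 'x set"
  assumes "m \<le> n" "\<And>r. m \<le> r \<Longrightarrow> r < n \<Longrightarrow> e \<notin> sym_diff (F r) (F (Suc r))"
  shows "e \<in> F m \<longleftrightarrow> e \<in> F n"
  using assms
proof (induction n rule: dec_induct)
  case (step n)
  then show ?case
    by (metis DiffI UnI1 UnI2 less_SucI less_Suc_eq)
qed simp

lemma excess_diff_eq:
  assumes "finite A" "finite B" "excess A v = excess B v"
  shows "excess (A - B) v = excess (B - A) v"
proof -
  have "excess ((A - B) \<union> (A \<inter> B)) v = excess (A - B) v + excess (A \<inter> B) v"
    "excess ((B - A) \<union> (A \<inter> B)) v = excess (B - A) v + excess (A \<inter> B) v"
    using assms(1,2) by (auto intro!: excess_Un_disjoint)
  moreover have "(A - B) \<union> (A \<inter> B) = A" "(B - A) \<union> (A \<inter> B) = B"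
    by auto
  ultimately show ?thesis
    using assms(3) by simp
qed

lemma tournament_antisym:
  assumes "tournament D" "(u, v) \<in> parcs D"
  shows "(v, u) \<notin> parcs D"
proof -
  interpret tournament D by fact
  show ?thesis
    using assms(2) exactly_one_arc[of u v] pair_no_loops[OF assms(2)] wellformed'[OF assms(2)] by auto
qed

lemma tournament_pair_wf: "tournament D \<Longrightarrow> pair_wf_digraph D"
  by (simp add: tournament_def pair_loopfree_digraph_def)

lemma tournament_reverse_cycle:
  assumes "tournament D" "F \<subseteq> parcs D"
  shows "tournament (reverse_cycle D F)"
proof -
  interpret tournament D by fact
  interpret R: pair_wf_digraph "reverse_cycle D F"
    using tournament_pair_wf[OF assms(1)] assms(2) by (rule pair_wf_digraph_reverse_cycle)
  show ?thesis
  proof unfold_locales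
    show "fst e \<noteq> snd e" if "e \<in> parcs (reverse_cycle D F)" for e
      using that assms(2) pair_no_loops by (fastforce simp: reverse_cycle_def)
    show "(u, v) \<in> parcs (reverse_cycle D F) \<longleftrightarrow> (v, u) \<notin> parcs (reverse_cycle D F)"
      if "u \<in> pverts (reverse_cycle D F)" "v \<in> pverts (reverse_cycle D F)" "u \<noteq> v" for u v
      using that exactly_one_arc[of u v] assms(2) by (auto simp: reverse_cycle_def)
  qed
qed

text \<open>Here \<open>F n\<close> is the set of arcs reversed after \<open>n\<close> steps.
  Consecutive sets differ by a balanced change, and pointwise convergence says that every arc
  changes only finitely often.\<close>

lemma cycle_reachable_sequence_limit:
  fixes F :: "nat \<Rightarrow> 'a rel"
  assumes "tournament D" "F 0 = {}" "\<And>n. finite (F n)" "\<And>n. F n \<subseteq> parcs D"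
    "\<And>n v. excess (F n) v = 0" and conv: "\<And>e. \<exists>N. \<forall>n\<ge>N. e \<in> F n \<longleftrightarrow> e \<in> F N"
  shows "cycle_reachable D (reverse_cycle D {e. \<exists>N. \<forall>n\<ge>N. e \<in> F n})"
proof (rule cycle_reachable_flips[where P = UNIV and F = F and F' = "\<lambda>n. F (Suc n)"])
  show "pair_wf_digraph D"
    using assms(1) by (rule tournament_pair_wf)
  show "(v, u) \<notin> parcs D" if "(u, v) \<in> parcs D" for u v
    using assms(1) that by (rule tournament_antisym)
  show "|UNIV :: nat set| \<le>o |UNIV :: ('a + nat) set|"
    by (rule card_of_ordLeqI[of Inr]) auto
  show "F p \<subseteq> parcs D \<and> F (Suc p) \<subseteq> parcs D" for p
    using assms(4) by auto
  show "{e. \<exists>N. \<forall>n\<ge>N. e \<in> F n} \<subseteq> parcs D"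
    using assms(4) by blast
  show "finite (sym_diff (F p) (F (Suc p)))" for p
    using assms(3) by auto
  show "excess (F (Suc p) - F p) v = excess (F p - F (Suc p)) v" for p v
    using assms(3,5) by (simp add: excess_diff_eq)
  show "finite {p \<in> UNIV. e \<in> sym_diff (F p) (F (Suc p))}" for e
  proof -
    obtain N where N: "\<forall>n\<ge>N. e \<in> F n \<longleftrightarrow> e \<in> F N"
      using conv by blast
    have "{p \<in> UNIV. e \<in> sym_diff (F p) (F (Suc p))} \<subseteq> {..<N}"
    proof
      fix p assume "p \<in> {p \<in> UNIV. e \<in> sym_diff (F p) (F (Suc p))}"
      then show "p \<in> {..<N}"
        using N[rule_format, of p] N[rule_format, of "Suc p"] by (cases "p < N") auto
    qed
    then show ?thesis
      using finite_subset by blast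
  qed
  have init: "\<exists>q<p. e \<in> sym_diff (F q) (F (Suc q))" if "e \<in> F p" for p e
    using unchanged_between[of 0 p e F] that assms(2) by auto
  then show "\<exists>q\<in>UNIV. q < p \<and> e \<in> sym_diff (F q) (F (Suc q))" if "e \<in> F p" for p e
    using that by blast
  show "\<exists>q\<in>UNIV. e \<in> sym_diff (F q) (F (Suc q))" if "e \<in> {e. \<exists>N. \<forall>n\<ge>N. e \<in> F n}" for e
    using init that by blast
  show "e \<in> F (Suc q) \<longleftrightarrow> e \<in> F p"
    if "q < p" "\<And>r. r \<in> UNIV \<Longrightarrow> q < r \<Longrightarrow> r < p \<Longrightarrow> e \<notin> sym_diff (F r) (F (Suc r))" for p q e
    using unchanged_between[of "Suc q" p e F] that by auto
  show "e \<in> F (Suc q) \<longleftrightarrow> e \<in> {e. \<exists>N. \<forall>n\<ge>N. e \<in> F n}"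
    if unchanged: "\<And>r. r \<in> UNIV \<Longrightarrow> q < r \<Longrightarrow> e \<notin> sym_diff (F r) (F (Suc r))" for q e
  proof -
    have same: "e \<in> F (Suc q) \<longleftrightarrow> e \<in> F n" if "n \<ge> Suc q" for n
      using that by (rule unchanged_between) (rule unchanged, simp_all)
    show ?thesis
    proof
      assume "e \<in> F (Suc q)"
      then show "e \<in> {e. \<exists>N. \<forall>n\<ge>N. e \<in> F n}"
        using same by blast
    next
      assume "e \<in> {e. \<exists>N. \<forall>n\<ge>N. e \<in> F n}"
      then obtain N where "\<forall>n\<ge>N. e \<in> F n"
        by blast
      then show "e \<in> F (Suc q)"
        using same[of "max N (Suc q)"] by simp
    qed
  qed
qed

section \<open>Splits of a uniform tournament\<close>

definition leaving :: "'a pair_pre_digraph \<Rightarrow> 'a set \<Rightarrow> 'a rel" where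
  "leaving D A = {(u, v) \<in> parcs D. u \<in> A \<and> v \<notin> A}"

text \<open>In a tournament this yields the degree conditions: for \<open>v\<close> in
  \<open>A\<close> its in-neighbours in \<open>A\<close> lie in \<open>A - out_nbhd D v\<close>, and
  for \<open>v\<close> outside \<open>A\<close> its out-neighbours outside \<open>A\<close> lie in
  \<open>out_nbhd D v - A\<close>.\<close>

definition splits :: "'b rel \<Rightarrow> 'a pair_pre_digraph \<Rightarrow> 'a set \<Rightarrow> bool" where
  "splits \<kappa> D A \<longleftrightarrow> A \<subseteq> pverts D \<and> (\<forall>v \<in> pverts D. |sym_diff (out_nbhd D v) A| <o \<kappa>)"

section \<open>Small sets, and splits with finitely many leaving arcs\<close>

lemma small_subset: "|X| <o \<kappa> \<Longrightarrow> Y \<subseteq> X \<Longrightarrow> |Y| <o \<kappa>"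
  by (rule ordLeq_ordLess_trans[OF card_of_mono1])

lemma small_image: "|X| <o \<kappa> \<Longrightarrow> |f ` X| <o \<kappa>"
  by (rule ordLeq_ordLess_trans[OF card_of_image])

lemma finite_small: "Cinfinite \<kappa> \<Longrightarrow> finite X \<Longrightarrow> |X| <o \<kappa>"
  by (intro finite_ordLess_infinite) (auto simp: cinfinite_def Field_card_of card_of_well_order_on card_order_on_well_order_on)

lemma small_UN_finite:
  assumes "Cinfinite \<kappa>" "finite I" "\<And>i. i \<in> I \<Longrightarrow> |f i| <o \<kappa>"
  shows "|\<Union>i\<in>I. f i| <o \<kappa>"
  using assms(2,3)
proof (induction I)
  case empty
  then show ?case
    by (simp add: finite_small[OF assms(1)])
next
  case (insert i I)
  then have "|f i \<union> (\<Union>i\<in>I. f i)| <o \<kappa>"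
    using assms(1) by (intro Un_Cinfinite_bound_strict) auto
  then show ?case
    by simp
qed

lemma splits_cong:
  assumes "Cinfinite \<kappa>" "splits \<kappa> D A" "A' \<subseteq> pverts D" "|sym_diff A A'| <o \<kappa>"
  shows "splits \<kappa> D A'"
  unfolding splits_def
proof (intro conjI ballI)
  fix v assume "v \<in> pverts D"
  then have "|sym_diff (out_nbhd D v) A \<union> sym_diff A A'| <o \<kappa>"
    using assms unfolding splits_def by (intro Un_Cinfinite_bound_strict[of "sym_diff _ _"]) blast+
  then show "|sym_diff (out_nbhd D v) A'| <o \<kappa>"
    by (rule small_subset) auto
qed fact

text \<open>The limit set \<open>L\<close> of reversed arcs contains \<open>(a, b)\<close> and
  otherwise only arcs within \<open>A\<close>. Among the latter each vertex is left and entered at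
  most once, as on the paths; so every out-neighbourhood changes by finitely many vertices, and
  \<open>A\<close> still splits.\<close>

lemma remove_leaving_arc:
  fixes D :: "'a pair_pre_digraph"
  assumes "Cinfinite \<kappa>" "tournament D" "splits \<kappa> D A" "(a, b) \<in> leaving D A"
    and inf: "infinite {x. (x, a) \<in> (parcs D \<inter> A \<times> A)\<^sup>* \<and> (b, x) \<in> parcs D}"
  shows "\<exists>E. cycle_reachable D E \<and> tournament E \<and> splits \<kappa> E A \<and>
    leaving E A = leaving D A - {(a, b)}"
proof -
  let ?R = "parcs D \<inter> A \<times> A"
  have ab: "(a, b) \<in> parcs D" "a \<in> A" "b \<notin> A"
    using assms(4) by (auto simp: leaving_def)
  obtain y :: "nat \<Rightarrow> 'a" where y: "inj y" "\<And>n. (y n, a) \<in> ?R\<^sup>*" "\<And>n. (b, y n) \<in> parcs D"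
    using infinite_countable_subset[OF inf] by auto
  have "\<exists>p. pcas (y n) p a \<and> set p \<subseteq> ?R \<and> distinct p \<and> single_valued (set p) \<and>
      single_valued ((set p)\<inverse>)" for n
    by (rule rtrancl_simple_walk[OF y(2)])
  then obtain p where p: "\<And>n. pcas (y n) (p n) a" "\<And>n. set (p n) \<subseteq> ?R" "\<And>n. distinct (p n)"
      "\<And>n. single_valued (set (p n))" "\<And>n. single_valued ((set (p n))\<inverse>)"
    by metis
  define W where "W n = set ((b, y n) # p n @ [(a, b)])" for n
  have walk: "pcas b ((b, y n) # p n @ [(a, b)]) b" "distinct ((b, y n) # p n @ [(a, b)])" for n
    using pcas_append[OF p(1)[of n], of "[(a, b)]" b] p(2,3)[of n] ab by auto
  have yA: "y n \<in> A" for n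
    using y(2)[of n] ab(2) by (auto elim: converse_rtranclE)
  have "finite (W n)" for n
    by (simp add: W_def)
  from convergent_subsequence_sets[of W, OF this]
  obtain s :: "nat \<Rightarrow> nat" where s: "strict_mono s" "\<forall>e. \<exists>N. \<forall>n\<ge>N. e \<in> W (s n) \<longleftrightarrow> e \<in> W (s N)"
    by blast
  \<comment> \<open>Shifted by one, since nothing is reversed at the start.\<close>
  define F where "F n = (case n of 0 \<Rightarrow> {} | Suc k \<Rightarrow> W (s k))" for n
  define L where "L = {e. \<exists>N. \<forall>n\<ge>N. e \<in> F n}"
  have W_sub: "W n \<subseteq> parcs D" for n
    using p(2)[of n] y(3) ab(1) by (auto simp: W_def)
  have reach: "cycle_reachable D (reverse_cycle D L)"
    unfolding L_def
  proof (rule cycle_reachable_sequence_limit)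
    show "finite (F n)" "F n \<subseteq> parcs D" for n
      using W_sub by (auto simp: F_def W_def split: nat.split)
    show "excess (F n) v = 0" for n v
    proof (cases n)
      case 0
      then show ?thesis
        by (simp add: F_def excess_def)
    next
      case (Suc k)
      then show ?thesis
        using excess_walk[OF walk, of "s k" v] by (simp add: F_def W_def)
    qed
    show "\<exists>N. \<forall>n\<ge>N. e \<in> F n \<longleftrightarrow> e \<in> F N" for e
    proof -
      obtain N where N: "\<forall>n\<ge>N. e \<in> W (s n) \<longleftrightarrow> e \<in> W (s N)"
        using s(2) by blast
      have "e \<in> F n \<longleftrightarrow> e \<in> F (Suc N)" if n: "n \<ge> Suc N" for n
      proof -
        obtain m where "n = Suc m" "m \<ge> N"
          using n by (cases n) auto
        then show ?thesis
          using N[rule_format, of m] by (simp add: F_def)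
      qed
      then show ?thesis
        by blast
    qed
  qed (simp_all add: F_def assms(2))
  have LW: "\<exists>N. \<forall>n\<ge>N. e \<in> W (s n)" if e: "e \<in> L" for e
  proof -
    obtain N where N: "\<forall>n\<ge>N. e \<in> F n"
      using e by (auto simp: L_def)
    have "e \<in> W (s n)" if "n \<ge> N" for n
      using N[rule_format, of "Suc n"] that by (simp add: F_def)
    then show ?thesis
      by blast
  qed
  \<comment> \<open>An arc of \<open>L\<close> lies on two consecutive cycles of the subsequence.
    Their arcs out of \<open>b\<close> end in distinct \<open>y\<close>, so it is none of
    these.\<close>
  have L_sub: "L \<subseteq> insert (a, b) ?R"
  proof
    fix e assume e: "e \<in> L"
    then obtain N where N: "\<forall>n\<ge>N. e \<in> W (s n)"
      using LW by blast
    have "s N \<noteq> s (Suc N)"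
      using s(1) by (metis lessI less_irrefl strict_mono_less)
    then have "y (s N) \<noteq> y (s (Suc N))"
      using y(1) by (auto simp: inj_eq)
    moreover have "e \<in> W (s N)" "e \<in> W (s (Suc N))"
      using N by auto
    ultimately show "e \<in> insert (a, b) ?R"
      using p(2)[of "s N"] p(2)[of "s (Suc N)"] by (auto simp: W_def)
  qed
  have abL: "(a, b) \<in> L"
    by (auto simp: L_def F_def W_def intro!: exI[of _ 1] split: nat.split)
  have L_parcs: "L \<subseteq> parcs D"
    using L_sub ab by auto
  \<comment> \<open>Two arcs of \<open>L\<close> lie together on all late cycles, so conditions on
    pairs of arcs are inherited from a single path.\<close>
  have in_p: "\<exists>n. e \<in> set (p n) \<and> e' \<in> set (p n)" if e: "e \<in> L \<inter> ?R" "e' \<in> L \<inter> ?R" for e e'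
  proof -
    obtain N where N: "\<forall>n\<ge>N. e \<in> W (s n)"
      using e LW by blast
    obtain N' where N': "\<forall>n\<ge>N'. e' \<in> W (s n)"
      using e LW by blast
    have "e \<in> W (s (max N N'))" "e' \<in> W (s (max N N'))"
      using N N' by simp_all
    then show ?thesis
      using e ab(3) by (intro exI[of _ "s (max N N')"]) (auto simp: W_def)
  qed
  have "w = w'" if "(v, w) \<in> L \<inter> ?R" "(v, w') \<in> L \<inter> ?R" for v w w'
    using in_p[OF that] p(4) by (auto dest: single_valuedD)
  then have sv: "single_valued (L \<inter> ?R)"
    unfolding single_valued_def by blast
  have "w = w'" if "(w, v) \<in> L \<inter> ?R" "(w', v) \<in> L \<inter> ?R" for v w w'
  proof -
    obtain n where "(v, w) \<in> (set (p n))\<inverse>" "(v, w') \<in> (set (p n))\<inverse>"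
      using in_p[OF \<open>(w, v) \<in> L \<inter> ?R\<close> \<open>(w', v) \<in> L \<inter> ?R\<close>] by blast
    then show ?thesis
      using p(5) by (rule single_valuedD[rotated])
  qed
  then have sv': "single_valued ((L \<inter> ?R)\<inverse>)"
    unfolding single_valued_def by blast
  have fin: "finite {w. (v, w) \<in> L \<inter> ?R}" "finite {w. (w, v) \<in> L \<inter> ?R}" for v
  proof -
    have *: "finite {w. (v, w) \<in> S}" if "single_valued S" for S :: "'a rel"
    proof (cases "\<exists>w. (v, w) \<in> S")
      case True
      then obtain w where "(v, w) \<in> S"
        by blast
      with \<open>single_valued S\<close> have "{w. (v, w) \<in> S} \<subseteq> {w}"
        by (auto dest: single_valuedD)
      then show ?thesis
        by (meson finite.emptyI finite_insert finite_subset)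
    qed simp
    show "finite {w. (v, w) \<in> L \<inter> ?R}" "finite {w. (w, v) \<in> L \<inter> ?R}"
      using *[OF sv] *[OF sv'] by simp_all
  qed
  have "splits \<kappa> (reverse_cycle D L) A"
    unfolding splits_def
  proof (intro conjI ballI)
    show "A \<subseteq> pverts (reverse_cycle D L)"
      using assms(3) by (simp add: splits_def reverse_cycle_def)
    fix v assume "v \<in> pverts (reverse_cycle D L)"
    then have "|sym_diff (out_nbhd D v) A| <o \<kappa>"
      using assms(3) by (simp add: splits_def reverse_cycle_def)
    \<comment> \<open>The set \<open>{a, b}\<close> accounts for the reversal of
      \<open>(a, b)\<close>, the other two for the reversed arcs within \<open>A\<close> at
      \<open>v\<close>.\<close>
    moreover have "|{a, b} \<union> {w. (v, w) \<in> L \<inter> ?R} \<union> {w. (w, v) \<in> L \<inter> ?R}| <o \<kappa>"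
      using fin by (intro finite_small assms(1)) auto
    ultimately have "|sym_diff (out_nbhd D v) A \<union>
        ({a, b} \<union> {w. (v, w) \<in> L \<inter> ?R} \<union> {w. (w, v) \<in> L \<inter> ?R})| <o \<kappa>"
      using assms(1) by (rule Un_Cinfinite_bound_strict)
    then show "|sym_diff (out_nbhd (reverse_cycle D L) v) A| <o \<kappa>"
      by (rule small_subset) (use L_sub in \<open>auto simp: out_nbhd_def reverse_cycle_def\<close>)
  qed
  moreover have "leaving (reverse_cycle D L) A = leaving D A - {(a, b)}"
    using L_sub ab abL by (auto simp: leaving_def reverse_cycle_def)
  ultimately show ?thesis
    using reach tournament_reverse_cycle[OF assms(2) L_parcs] by blast
qed

text \<open>Induction on the number of leaving arcs: either all ancestor sets of their tails within
  \<open>A\<close> are small and can be cut off, or one leaving arc can be removed by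
  reversals.\<close>

lemma reach_closed_split_if_finite:
  assumes "Cinfinite \<kappa>" "tournament D" "splits \<kappa> D A" "finite (leaving D A)"
  shows "\<exists>E A'. cycle_reachable D E \<and> tournament E \<and> splits \<kappa> E A' \<and> leaving E A' = {}"
  using assms(2-)
proof (induction "card (leaving D A)" arbitrary: D rule: less_induct)
  case less
  let ?anc = "\<lambda>a. {x. (x, a) \<in> (parcs D \<inter> A \<times> A)\<^sup>*}"
  have sub: "?anc a \<subseteq> A" if "a \<in> A" for a
    using that by (auto elim: converse_rtranclE)
  show ?case
  proof (cases "\<forall>(a, b) \<in> leaving D A. |?anc a| <o \<kappa>")
    case True
    define X where "X = (\<Union>e \<in> leaving D A. ?anc (fst e))"
    have "|X| <o \<kappa>"
      unfolding X_def using True less.prems(3) by (intro small_UN_finite assms(1)) auto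
    have "X \<subseteq> A"
      using sub by (fastforce simp: X_def leaving_def)
    have "A \<subseteq> pverts D"
      using less.prems(2) by (simp add: splits_def)
    have "splits \<kappa> D (A - X)"
    proof (rule splits_cong[OF assms(1) less.prems(2)])
      show "|sym_diff A (A - X)| <o \<kappa>"
        using \<open>|X| <o \<kappa>\<close> by (rule small_subset) auto
    qed (use \<open>A \<subseteq> pverts D\<close> in auto)
    \<comment> \<open>The tail of an arc into \<open>X\<close> within \<open>A\<close> would itself
      be an ancestor, and the tail of an arc leaving \<open>A\<close> is its own ancestor; both lie
      in \<open>X\<close>.\<close>
    moreover have "leaving D (A - X) = {}"
    proof (rule ccontr)
      assume "leaving D (A - X) \<noteq> {}"
      then obtain u v where uv: "(u, v) \<in> parcs D" "u \<in> A" "u \<notin> X" "v \<notin> A \<or> v \<in> X"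
        by (auto simp: leaving_def)
      show False
      proof (cases "v \<in> A")
        case True
        then obtain e where e: "e \<in> leaving D A" "(v, fst e) \<in> (parcs D \<inter> A \<times> A)\<^sup>*"
          using uv by (auto simp: X_def)
        then have "(u, fst e) \<in> (parcs D \<inter> A \<times> A)\<^sup>*"
          using uv True by (auto intro: converse_rtrancl_into_rtrancl)
        then show False
          using e(1) uv(3) by (auto simp: X_def)
      next
        case False
        then have "(u, v) \<in> leaving D A"
          using uv by (auto simp: leaving_def)
        then show False
          using uv(3) by (force simp: X_def)
      qed
    qed
    ultimately show ?thesis
      using cycle_reachable_refl less.prems(1) by blast
  next
    case False
    then obtain a b where ab: "(a, b) \<in> leaving D A" "\<not> |?anc a| <o \<kappa>"
      by auto
    \<comment> \<open>The out-neighbourhood of \<open>b\<close> misses only a small part of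
      \<open>A\<close>, hence not almost all of the ancestors of \<open>a\<close>.\<close>
    have "infinite {x. (x, a) \<in> (parcs D \<inter> A \<times> A)\<^sup>* \<and> (b, x) \<in> parcs D}" (is "infinite ?Y")
    proof
      assume "finite ?Y"
      moreover have "b \<in> pverts D"
        using ab(1) tournament_pair_wf[OF less.prems(1)] by (auto simp: leaving_def pair_wf_digraph.in_arcsD2)
      then have "|sym_diff (out_nbhd D b) A| <o \<kappa>"
        using less.prems(2) by (simp add: splits_def)
      ultimately have "|?Y \<union> sym_diff (out_nbhd D b) A| <o \<kappa>"
        using Un_Cinfinite_bound_strict finite_small assms(1) by blast
      moreover have "?anc a \<subseteq> ?Y \<union> sym_diff (out_nbhd D b) A"
        using sub[of a] ab(1) by (auto simp: leaving_def out_nbhd_def)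
      ultimately have "|?anc a| <o \<kappa>"
        by (rule small_subset)
      with ab(2) show False
        by blast
    qed
    from remove_leaving_arc[OF assms(1) less.prems(1,2) ab(1) this]
    obtain E where E: "cycle_reachable D E" "tournament E" "splits \<kappa> E A"
        "leaving E A = leaving D A - {(a, b)}"
      by blast
    have "card (leaving E A) < card (leaving D A)" "finite (leaving E A)"
      using card_Diff1_less[OF less.prems(3) ab(1)] less.prems(3) by (simp_all add: E(4))
    with less.hyps[OF _ E(2,3)] obtain E' A' where "cycle_reachable E E'" "tournament E'"
        "splits \<kappa> E' A'" "leaving E' A' = {}"
      by blast
    then show ?thesis
      using cycle_reachable_trans[OF E(1)] by blast
  qed
qed

section \<open>Splits with infinitely many leaving arcs\<close>

lemma Cinfinite_card_of: "infinite X \<Longrightarrow> Cinfinite |X|"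
  by (simp add: cinfinite_def Field_card_of card_of_card_order_on)

lemma small_UN_finite_sets:
  assumes "infinite X" "|J| <o |X|" "\<And>j. j \<in> J \<Longrightarrow> finite (f j)"
  shows "|\<Union>j\<in>J. f j| <o |X|"
proof (cases "finite J")
  case True
  then show ?thesis
    using assms by (intro finite_small Cinfinite_card_of) auto
next
  case False
  then have "|\<Union>j\<in>J. f j| \<le>o |J|"
    using assms(3) ordLess_imp_ordLeq[OF finite_small[OF Cinfinite_card_of]]
    by (intro card_of_UNION_ordLeq_infinite ordIso_imp_ordLeq[OF card_of_refl]) blast+
  then show ?thesis
    using assms(2) ordLeq_ordLess_trans by blast
qed

text \<open>Recursion along the cardinal \<open>|I|\<close>: before \<open>i\<close> fewer than
  \<open>|I|\<close> finite sets have been chosen, so their union is small enough to be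
  avoided.\<close>

lemma disjoint_finite_selection:
  fixes I :: "'i set" and Q :: "'i \<Rightarrow> 'x set \<Rightarrow> bool"
  assumes "infinite I"
    and ex: "\<And>i S. i \<in> I \<Longrightarrow> |S :: 'x set| <o |I| \<Longrightarrow> \<exists>T. finite T \<and> Q i T \<and> T \<inter> S = {}"
  shows "\<exists>T. (\<forall>i\<in>I. finite (T i) \<and> Q i (T i)) \<and> (\<forall>i\<in>I. \<forall>j\<in>I. i \<noteq> j \<longrightarrow> T i \<inter> T j = {})"
proof -
  let ?r = "|I|"
  have W: "Well_order ?r" and F: "Field ?r = I"
    by (rule card_of_Well_order, rule Field_card_of)
  \<comment> \<open>The recursion assigns a set to every element of the type, hence the premise
    \<open>i \<in> I\<close>.\<close>
  define P where "P T i X \<longleftrightarrow>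
    i \<in> I \<longrightarrow> finite X \<and> Q i X \<and> (\<forall>j. (j, i) \<in> ?r - Id \<longrightarrow> X \<inter> T j = {})"
    for T :: "'i \<Rightarrow> 'x set" and i X
  have "\<exists>T. \<forall>i. P T i (T i)"
  proof (rule dependent_wf_choice)
    show "wf (?r - Id)"
      using W by (simp add: well_order_on_def)
    show "P f x X = P g x X" if "\<And>z. (z, x) \<in> ?r - Id \<Longrightarrow> f z = g z" for f g x X
      using that unfolding P_def by metis
    show "\<exists>X. P T i X" if IH: "\<And>j. (j, i) \<in> ?r - Id \<Longrightarrow> P T j (T j)" for i T
    proof (cases "i \<in> I")
      case True
      have "|underS ?r i| <o |I|"
        using True by (intro card_of_underS card_of_Card_order) (simp add: F)
      moreover have "finite (T j)" if "j \<in> underS ?r i" for j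
      proof -
        have "(j, i) \<in> ?r - Id"
          using that by (auto simp: underS_def)
        moreover from this have "j \<in> I"
          using F by (auto simp: Field_def)
        ultimately show ?thesis
          using IH by (auto simp: P_def)
      qed
      ultimately have "|\<Union>j\<in>underS ?r i. T j| <o |I|"
        using assms(1) by (intro small_UN_finite_sets)
      then obtain X where "finite X" "Q i X" "X \<inter> (\<Union>j\<in>underS ?r i. T j) = {}"
        using ex[OF True] by blast
      then have "P T i X"
        unfolding P_def underS_def by blast
      then show ?thesis ..
    qed (simp add: P_def)
  qed
  then obtain T where T: "\<And>i. P T i (T i)"
    by blast
  have "T i \<inter> T j = {}" if "i \<in> I" "j \<in> I" "i \<noteq> j" for i j
  proof -
    have "(i, j) \<in> ?r - Id \<or> (j, i) \<in> ?r - Id"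
      using W that F by (auto simp: well_order_on_def linear_order_on_def total_on_def)
    then show ?thesis
      using T[of i] T[of j] that unfolding P_def by blast
  qed
  then show ?thesis
    using T unfolding P_def by (intro exI[of _ T]) blast
qed

text \<open>
  A path from \<open>b\<close> back to \<open>a\<close> survives the deletion of few arcs: otherwise the vertices still
  reachable from \<open>b\<close> would form a split with fewer leaving arcs.
\<close>

lemma return_path_avoiding:
  fixes D :: "'a pair_pre_digraph"
  assumes "Cinfinite \<kappa>" "tournament D" "splits \<kappa> D A" "|leaving D A| \<le>o \<kappa>"
    and min: "\<And>A'. splits \<kappa> D A' \<Longrightarrow> |leaving D A| \<le>o |leaving D A'|"
    and ab: "(a, b) \<in> leaving D A" and S: "|S| <o |leaving D A|"
  shows "(b, a) \<in> (parcs D - S)\<^sup>*"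
proof (rule ccontr)
  assume not: "(b, a) \<notin> (parcs D - S)\<^sup>*"
  interpret tournament D by fact
  define R where "R = {x. (b, x) \<in> (parcs D - S)\<^sup>*}"
  have V: "a \<in> pverts D" "b \<in> pverts D" and a: "a \<in> A"
    using ab wellformed' by (auto simp: leaving_def)
  have S_small: "|S| <o \<kappa>"
    using S assms(4) by (rule ordLess_ordLeq_trans)
  have "x \<in> pverts D" if "x \<in> R" for x
  proof -
    have "(b, x) \<in> (parcs D - S)\<^sup>*"
      using that by (simp add: R_def)
    then show ?thesis
      using V(2) wellformed' by (induction rule: rtrancl_induct) auto
  qed
  then have R_sub: "R \<subseteq> pverts D"
    by blast
  have step: "y \<in> R" if "x \<in> R" "(x, y) \<in> parcs D" "(x, y) \<notin> S" for x y
    using that unfolding R_def by (auto intro: rtrancl_into_rtrancl)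
  \<comment> \<open>A vertex of \<open>A\<close> outside \<open>R\<close> is no out-neighbour of
    \<open>b\<close> unless the arc is in \<open>S\<close>. A vertex of \<open>R\<close> outside
    \<open>A\<close> has no arc to \<open>a\<close> outside \<open>S\<close>; apart from the tails
    of arcs in \<open>S\<close> it is thus an out-neighbour of \<open>a\<close> missing from
    \<open>A\<close>.\<close>
  have "splits \<kappa> D R"
  proof (rule splits_cong[OF assms(1,3) R_sub])
    have 1: "A - R \<subseteq> sym_diff (out_nbhd D b) A \<union> snd ` S"
    proof
      fix x assume x: "x \<in> A - R"
      show "x \<in> sym_diff (out_nbhd D b) A \<union> snd ` S"
      proof (cases "(b, x) \<in> parcs D")
        case True
        have "b \<in> R"
          by (simp add: R_def)
        then have "(b, x) \<in> S"
          using step[of b x] True x by auto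
        then show ?thesis
          by force
      next
        case False
        then show ?thesis
          using x by (simp add: out_nbhd_def)
      qed
    qed
    have 2: "R - A \<subseteq> sym_diff (out_nbhd D a) A \<union> fst ` S"
    proof
      fix x assume x: "x \<in> R - A"
      show "x \<in> sym_diff (out_nbhd D a) A \<union> fst ` S"
      proof (cases "(x, a) \<in> parcs D")
        case True
        then have "(x, a) \<in> S"
          using step[of x a] not x by (auto simp: R_def)
        then show ?thesis
          by force
      next
        case False
        then have "(a, x) \<in> parcs D"
          using exactly_one_arc[of a x] x a V(1) R_sub by blast
        then show ?thesis
          using x by (simp add: out_nbhd_def)
      qed
    qed
    have "|sym_diff (out_nbhd D b) A \<union> snd ` S| <o \<kappa>" "|sym_diff (out_nbhd D a) A \<union> fst ` S| <o \<kappa>"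
      using Un_Cinfinite_bound_strict[OF _ small_image[OF S_small] assms(1)] assms(3) V
      unfolding splits_def by blast+
    then have "|(sym_diff (out_nbhd D b) A \<union> snd ` S) \<union> (sym_diff (out_nbhd D a) A \<union> fst ` S)| <o \<kappa>"
      using assms(1) by (rule Un_Cinfinite_bound_strict)
    then show "|sym_diff A R| <o \<kappa>"
      by (rule small_subset) (use 1 2 in blast)
  qed
  then have "|leaving D A| \<le>o |leaving D R|"
    by (rule min)
  \<comment> \<open>Reachability is closed under arcs outside \<open>S\<close>, so \<open>R\<close>
    contradicts the minimality of \<open>A\<close>.\<close>
  also have "leaving D R \<subseteq> S"
    using step by (auto simp: leaving_def)
  then have "|leaving D R| \<le>o |S|"
    by (rule card_of_mono1)
  finally show False
    using S not_ordLess_ordLeq by blast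
qed

text \<open>Steps are pairs of a stage, one for each leaving arc, and a number counting return
  paths. The stages are ordered like the cardinal of the leaving arcs, so fewer than that many arcs
  precede each stage and the return paths can avoid them.\<close>

lemma reach_closed_split_if_infinite:
  fixes D :: "'a pair_pre_digraph"
  assumes "Cinfinite \<kappa>" "tournament D" "splits \<kappa> D A" "|leaving D A| \<le>o \<kappa>"
    and min: "\<And>A'. splits \<kappa> D A' \<Longrightarrow> |leaving D A| \<le>o |leaving D A'|"
    and inf: "infinite (leaving D A)"
  shows "cycle_reachable D (reverse_cycle D (leaving D A))"
proof -
  define X where "X = leaving D A"
  have X_sub: "X \<subseteq> parcs D" and X_inf: "infinite X"
    using inf by (auto simp: X_def leaving_def)
  have X_card: "|X| \<le>o |UNIV :: ('a + nat) set|"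
  proof -
    have "|X| \<le>o |(UNIV :: ('a + nat) set) \<times> (UNIV :: ('a + nat) set)|"
      by (rule card_of_ordLeqI[of "map_prod Inl Inl"]) (auto simp: inj_on_def)
    also have "|(UNIV :: ('a + nat) set) \<times> (UNIV :: ('a + nat) set)| \<le>o |UNIV :: ('a + nat) set|"
      by (rule ordIso_imp_ordLeq[OF card_of_Times_same_infinite]) simp
    finally show ?thesis .
  qed
  let ?r = "|X|"
  have F: "Field ?r = X" and W: "Well_order ?r" and C: "Card_order ?r"
    by (rule Field_card_of, rule card_of_Well_order, rule card_of_Card_order)
  from ordinal_enumeration[OF W, unfolded F, OF X_card]
  obtain f :: "'a \<times> 'a \<Rightarrow> 'a ordinal" and l where f: "bij_betw f X {..<l}"
    and ord: "\<And>x y. x \<in> X \<Longrightarrow> y \<in> X \<Longrightarrow> (x, y) \<in> ?r \<longleftrightarrow> f x \<le> f y"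
    by blast
  define g where "g = inv_into X f"
  have gf: "g (f x) = x" if "x \<in> X" for x
    using f that by (simp add: g_def bij_betw_def)
  have gX: "g \<alpha> \<in> X" and fg: "f (g \<alpha>) = \<alpha>" if "\<alpha> < l" for \<alpha>
    using f that by (auto simp: g_def bij_betw_def inv_into_into f_inv_into_f)
  have fl: "f x < l" if "x \<in> X" for x
    using f that by (auto simp: bij_betw_def)
  \<comment> \<open>The leaving arcs already reversed when the stage of \<open>x\<close> is under
    way, including \<open>x\<close> itself; return paths for \<open>x\<close> must not use
    them.\<close>
  define K where "K x = {z \<in> X. f z \<le> f x}" for x
  have K_small: "|K x| <o |X|" if "x \<in> X" for x
  proof -
    have "|underS ?r x| <o ?r"
      using that F by (intro card_of_underS C) simp
    moreover have "|{x}| <o |X|"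
      using X_inf by (intro finite_small Cinfinite_card_of) auto
    ultimately have "|underS ?r x \<union> {x}| <o ?r"
      using Cinfinite_card_of[OF X_inf] by (rule Un_Cinfinite_bound_strict)
    moreover have "K x \<subseteq> underS ?r x \<union> {x}"
    proof
      fix z assume "z \<in> K x"
      then show "z \<in> underS ?r x \<union> {x}"
        using ord[of z x] that by (simp add: K_def underS_def)
    qed
    ultimately show ?thesis
      by (rule small_subset)
  qed
  \<comment> \<open>The return path from the head of \<open>fst i\<close> to its tail is recorded by
    its excess, which balances that of the arc \<open>fst i\<close>.\<close>
  define Q where "Q i T \<longleftrightarrow> T \<subseteq> parcs D \<and> T \<inter> K (fst i) = {} \<and>
      (\<forall>v. excess T v = of_bool (v = snd (fst i)) - of_bool (v = fst (fst i)))"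
    for i :: "('a \<times> 'a) \<times> nat" and T
  let ?I = "X \<times> (UNIV :: nat set)"
  have I_card: "|?I| =o |X|"
    using X_inf by (intro card_of_Times_infinite_simps(1)) (auto simp: infinite_iff_card_of_nat)
  have "\<exists>T. (\<forall>i\<in>?I. finite (T i) \<and> Q i (T i)) \<and> (\<forall>i\<in>?I. \<forall>j\<in>?I. i \<noteq> j \<longrightarrow> T i \<inter> T j = {})"
  proof (rule disjoint_finite_selection)
    show "infinite ?I"
      using X_inf finite_cartesian_productD1[of X "UNIV :: nat set"] by auto
    fix i and S :: "('a \<times> 'a) set" assume i: "i \<in> ?I" and S: "|S| <o |?I|"
    obtain a b n where i_eq: "i = ((a, b), n)"
      by (cases i) auto
    have ab: "(a, b) \<in> X"
      using i i_eq by auto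
    have "|S| <o |X|"
      using S I_card by (rule ordLess_ordIso_trans)
    then have small: "|S \<union> K (a, b)| <o |X|"
      using K_small[OF ab] Cinfinite_card_of[OF X_inf] by (rule Un_Cinfinite_bound_strict)
    have "(b, a) \<in> (parcs D - (S \<union> K (a, b)))\<^sup>*"
      by (rule return_path_avoiding[OF assms(1-4) min ab[unfolded X_def] small[unfolded X_def]])
    from rtrancl_simple_walk[OF this] obtain p
      where p: "pcas b p a" "set p \<subseteq> parcs D - (S \<union> K (a, b))" "distinct p"
      by blast
    have "Q i (set p)"
      unfolding Q_def using p(2) excess_walk[OF p(1,3)] by (auto simp: i_eq)
    then show "\<exists>T. finite T \<and> Q i T \<and> T \<inter> S = {}"
      using p(2) by (intro exI[of _ "set p"]) auto
  qed
  then obtain T where T: "\<And>x n. x \<in> X \<Longrightarrow> finite (T (x, n))" "\<And>x n. x \<in> X \<Longrightarrow> Q (x, n) (T (x, n))"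
    and T_disj: "\<And>x n y m. x \<in> X \<Longrightarrow> y \<in> X \<Longrightarrow> (x, n) \<noteq> (y, m) \<Longrightarrow> T (x, n) \<inter> T (y, m) = {}"
    by (metis SigmaI UNIV_I)
  define B where "B \<alpha> = {z \<in> X. f z < \<alpha>}" for \<alpha>
  \<comment> \<open>The arcs reversed before step \<open>(\<alpha>, n)\<close>: those of earlier
    stages and, once stage \<alpha> has begun, \<open>g \<alpha>\<close> with its current return
    path. The value at \<open>n = 0\<close> is the limit of all earlier stages.\<close>
  define G where "G = (\<lambda>(\<alpha>, n :: nat). B \<alpha> \<union> (if n = 0 then {} else insert (g \<alpha>) (T (g \<alpha>, n))))"
  define G' where "G' = (\<lambda>(\<alpha>, n). G (\<alpha>, Suc n))"
  have G_0: "G (\<alpha>, 0) = B \<alpha>" and G_Suc: "G (\<alpha>, Suc n) = B \<alpha> \<union> insert (g \<alpha>) (T (g \<alpha>, Suc n))"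
    and G': "G' (\<alpha>, n) = G (\<alpha>, Suc n)" for \<alpha> n
    by (simp_all add: G_def G'_def)
  have T_B: "T (g \<alpha>, n) \<inter> B \<alpha> = {}" and T_g: "g \<alpha> \<notin> T (g \<alpha>, n)" and g_B: "g \<alpha> \<notin> B \<alpha>"
    if "\<alpha> < l" for \<alpha> n
    using T(2)[OF gX[OF that], of n] gX[OF that] fg[OF that] by (auto simp: Q_def K_def B_def)
  have change_0: "G' (\<alpha>, 0) - G (\<alpha>, 0) = insert (g \<alpha>) (T (g \<alpha>, 1))" "G (\<alpha>, 0) - G' (\<alpha>, 0) = {}"
    if "\<alpha> < l" for \<alpha>
    using T_B[OF that, of "Suc 0"] g_B[OF that] unfolding G' G_0 G_Suc One_nat_def by blast+
  have change_Suc: "G' (\<alpha>, Suc n) - G (\<alpha>, Suc n) = T (g \<alpha>, Suc (Suc n))"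
      "G (\<alpha>, Suc n) - G' (\<alpha>, Suc n) = T (g \<alpha>, Suc n)" if "\<alpha> < l" for \<alpha> n
  proof -
    have "T (g \<alpha>, Suc n) \<inter> T (g \<alpha>, Suc (Suc n)) = {}"
      using gX[OF that] by (intro T_disj) auto
    then show "G' (\<alpha>, Suc n) - G (\<alpha>, Suc n) = T (g \<alpha>, Suc (Suc n))"
      "G (\<alpha>, Suc n) - G' (\<alpha>, Suc n) = T (g \<alpha>, Suc n)"
      using T_B[OF that, of "Suc n"] T_B[OF that, of "Suc (Suc n)"]
        T_g[OF that, of "Suc n"] T_g[OF that, of "Suc (Suc n)"]
      unfolding G' G_Suc by blast+
  qed
  let ?ch = "\<lambda>e p. e \<in> sym_diff (G p) (G' p)"
  have ch_g: "?ch (g \<alpha>) (\<alpha>, 0)" if "\<alpha> < l" for \<alpha>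
    using change_0[OF that] by blast
  have ch_T: "?ch e (\<alpha>, n)" if "\<alpha> < l" "e \<in> T (g \<alpha>, Suc n)" for \<alpha> n e
    using change_0[OF that(1)] change_Suc[OF that(1)] that(2) by (cases n) auto
  have ch_T': "?ch e (\<alpha>, Suc n)" if "\<alpha> < l" "e \<in> T (g \<alpha>, Suc n)" for \<alpha> n e
    using change_Suc[OF that(1), of n] that(2) by blast
  have ch_D: "e = g \<alpha> \<and> n = 0 \<or> e \<in> T (g \<alpha>, Suc n) \<or> e \<in> T (g \<alpha>, n)" if "\<alpha> < l" "?ch e (\<alpha>, n)" for \<alpha> n e
  proof (cases n)
    case 0
    then show ?thesis
      using that(2) change_0[OF that(1)] by auto
  next
    case (Suc m)
    then show ?thesis
      using that(2) change_Suc[OF that(1), of m] by auto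
  qed
  have first: "\<exists>q. fst q < l \<and> q < (\<beta>, m) \<and> ?ch e q"
    if e: "e \<in> G (\<beta>, m)" and b: "\<beta> < l \<or> \<beta> = l \<and> m = 0" for e \<beta> m
  proof (cases "e \<in> B \<beta>")
    case True
    then have "e \<in> X" "f e < \<beta>" "f e < l"
      using fl by (auto simp: B_def)
    then show ?thesis
      using ch_g[of "f e"] gf[of e] by (intro exI[of _ "(f e, 0)"]) auto
  next
    case False
    then obtain k where k: "m = Suc k"
      using e by (cases m) (auto simp: G_0)
    then have "\<beta> < l" and "e = g \<beta> \<or> e \<in> T (g \<beta>, Suc k)"
      using e b False by (auto simp: G_Suc)
    then have "?ch e (\<beta>, 0) \<or> ?ch e (\<beta>, k)"
      using ch_g ch_T by blast
    then show ?thesis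
    proof
      assume "?ch e (\<beta>, 0)"
      then show ?thesis
        using \<open>\<beta> < l\<close> k by (intro exI[of _ "(\<beta>, 0)"]) auto
    next
      assume "?ch e (\<beta>, k)"
      then show ?thesis
        using \<open>\<beta> < l\<close> k by (intro exI[of _ "(\<beta>, k)"]) auto
    qed
  qed
  \<comment> \<open>Within one stage this is a finite induction. Across stages, an arc that is lost
    belongs to the return path at \<open>(\<alpha>, n)\<close>, which is replaced there; an arc that
    is gained is either a leaving arc treated at \<open>(f e, 0)\<close> or enters during stage
    \<beta>.\<close>
  have between: "\<exists>q. fst q < l \<and> (\<alpha>, n) \<le> q \<and> q < (\<beta>, m) \<and> ?ch e q"
    if le: "(\<alpha>, n) \<le> (\<beta>, m)" and a: "\<alpha> < l" and b: "\<beta> < l \<or> \<beta> = l \<and> m = 0"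
      and diff: "(e \<in> G (\<alpha>, n)) \<noteq> (e \<in> G (\<beta>, m))" for \<alpha> \<beta> n m e
  proof (cases "\<alpha> = \<beta>")
    case True
    then have "n \<le> m"
      using le by auto
    have "\<exists>k. n \<le> k \<and> k < m \<and> e \<in> sym_diff (G (\<beta>, k)) (G (\<beta>, Suc k))"
    proof (rule ccontr)
      assume "\<not> ?thesis"
      then have "e \<in> G (\<beta>, n) \<longleftrightarrow> e \<in> G (\<beta>, m)"
        by (intro unchanged_between[where F = "\<lambda>k. G (\<beta>, k)", OF \<open>n \<le> m\<close>]) blast
      with diff True show False
        by simp
    qed
    then obtain k where "n \<le> k" "k < m" "?ch e (\<beta>, k)"
      unfolding G' by blast
    then show ?thesis
      using True a by (intro exI[of _ "(\<beta>, k)"]) auto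
  next
    case False
    then have lt: "\<alpha> < \<beta>"
      using le by auto
    then have B: "B \<alpha> \<subseteq> B \<beta>" "g \<alpha> \<in> B \<beta>"
      using gX[OF a] fg[OF a] by (auto simp: B_def)
    show ?thesis
    proof (cases "e \<in> G (\<alpha>, n)")
      case True
      then have "e \<notin> B \<beta>"
        using diff by (auto simp: G_def)
      then obtain k where k: "n = Suc k" "e \<in> T (g \<alpha>, Suc k)"
        using True B by (cases n) (auto simp: G_0 G_Suc)
      then have "?ch e (\<alpha>, n)"
        using ch_T'[OF a] by blast
      then show ?thesis
        using lt a by (intro exI[of _ "(\<alpha>, n)"]) auto
    next
      case not_in: False
      then have e: "e \<in> G (\<beta>, m)"
        using diff by blast
      show ?thesis
      proof (cases "e \<in> B \<beta>")
        case True
        then have eX: "e \<in> X" "f e < \<beta>" "f e < l"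
          using fl by (auto simp: B_def)
        have "e \<notin> B \<alpha>"
          using not_in by (auto simp: G_def)
        then have "\<alpha> \<le> f e"
          using eX(1) by (auto simp: B_def)
        moreover have "n = 0" if "\<alpha> = f e"
          using not_in gf[OF eX(1)] that by (auto simp: G_def split: if_splits)
        ultimately have "(\<alpha>, n) \<le> (f e, 0)"
          by (auto simp: less_le)
        then show ?thesis
          using eX ch_g[of "f e"] gf[of e] by (intro exI[of _ "(f e, 0)"]) auto
      next
        case False
        then obtain k where k: "m = Suc k"
          using e by (cases m) (auto simp: G_0)
        then have "\<beta> < l" and "e = g \<beta> \<or> e \<in> T (g \<beta>, Suc k)"
          using e b False by (auto simp: G_Suc)
        then have "?ch e (\<beta>, 0) \<or> ?ch e (\<beta>, k)"
          using ch_g ch_T by blast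
        then show ?thesis
        proof
          assume "?ch e (\<beta>, 0)"
          then show ?thesis
            using \<open>\<beta> < l\<close> k lt by (intro exI[of _ "(\<beta>, 0)"]) auto
        next
          assume "?ch e (\<beta>, k)"
          then show ?thesis
            using \<open>\<beta> < l\<close> k lt by (intro exI[of _ "(\<beta>, k)"]) auto
        qed
      qed
    qed
  qed
  have G_l: "G (l, 0) = X"
    using fl by (auto simp: G_0 B_def)
  have G_sub: "G (\<alpha>, n) \<subseteq> parcs D" if "\<alpha> < l" for \<alpha> n
    using X_sub gX[OF that] T(2)[OF gX[OF that], of n] by (auto simp: G_def B_def Q_def split: if_splits)
  let ?P = "{..<l} \<times> (UNIV :: nat set)"
  have "cycle_reachable D (reverse_cycle D X)"
  proof (rule cycle_reachable_flips[where P = ?P and F = G and F' = G'])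
    show "pair_wf_digraph D"
      using assms(2) by (rule tournament_pair_wf)
    show "(v, u) \<notin> parcs D" if "(u, v) \<in> parcs D" for u v
      using assms(2) that by (rule tournament_antisym)
    show "|?P| \<le>o |UNIV :: ('a + nat) set|"
    proof (rule card_of_Times_ordLeq_infinite_Field)
      show "|UNIV :: nat set| \<le>o |UNIV :: ('a + nat) set|"
        by (rule card_of_ordLeqI[of Inr]) auto
    qed (simp_all add: Field_card_of card_of_card_order_on card_of_lessThan_ordinal)
    show "G p \<subseteq> parcs D \<and> G' p \<subseteq> parcs D" if "p \<in> ?P" for p
      using that G_sub by (cases p) (simp add: G')
    show "X \<subseteq> parcs D"
      by (rule X_sub)
    show "finite (sym_diff (G p) (G' p))" if p: "p \<in> ?P" for p
    proof -
      obtain \<alpha> n where p_eq: "p = (\<alpha>, n)" and \<alpha>: "\<alpha> < l"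
        using p by (cases p) auto
      show ?thesis
      proof (cases n)
        case 0
        show ?thesis
          unfolding p_eq 0 change_0[OF \<alpha>] using T(1)[OF gX[OF \<alpha>]] by simp
      next
        case (Suc k)
        show ?thesis
          unfolding p_eq Suc change_Suc[OF \<alpha>] using T(1)[OF gX[OF \<alpha>]] by simp
      qed
    qed
    \<comment> \<open>The first return path of a stage balances \<open>g \<alpha>\<close>; each
      further one has the same excess as the path it replaces.\<close>
    show "excess (G' p - G p) v = excess (G p - G' p) v" if p: "p \<in> ?P" for p v
    proof -
      obtain \<alpha> n where p_eq: "p = (\<alpha>, n)" and \<alpha>: "\<alpha> < l"
        using p by (cases p) auto
      have T_excess: "excess (T (g \<alpha>, k)) v = of_bool (v = snd (g \<alpha>)) - of_bool (v = fst (g \<alpha>))" for k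
        using T(2)[OF gX[OF \<alpha>], of k] by (simp add: Q_def)
      show ?thesis
      proof (cases n)
        case 0
        have "excess {g \<alpha>} v = of_bool (v = fst (g \<alpha>)) - of_bool (v = snd (g \<alpha>))"
          using excess_walk[of "fst (g \<alpha>)" "[g \<alpha>]" "snd (g \<alpha>)" v] by simp
        moreover have "excess ({g \<alpha>} \<union> T (g \<alpha>, 1)) v = excess {g \<alpha>} v + excess (T (g \<alpha>, 1)) v"
          using T(1)[OF gX[OF \<alpha>]] T_g[OF \<alpha>] by (intro excess_Un_disjoint) auto
        moreover have "excess {} v = 0"
          by (simp add: excess_def)
        ultimately show ?thesis
          unfolding p_eq 0 change_0[OF \<alpha>] by (simp add: T_excess)
      next
        case (Suc k)
        show ?thesis
          unfolding p_eq Suc change_Suc[OF \<alpha>] T_excess ..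
      qed
    qed
    show "finite {p \<in> ?P. ?ch e p}" for e
    proof -
      \<comment> \<open>By disjointness \<open>e\<close> lies on at most one
        \<open>T (x, n)\<close>. It can then change only on entering at \<open>n - 1\<close>, on
        leaving at \<open>n\<close>, or as a leaving arc in its own stage at
        \<open>0\<close>.\<close>
      let ?Z = "{(x, n). x \<in> X \<and> e \<in> T (x, n)}"
      have unique: "i = j" if "i \<in> ?Z" "j \<in> ?Z" for i j
        using that T_disj[of "fst i" "fst j" "snd i" "snd j"] by (cases i; cases j) auto
      have "finite ?Z"
      proof (cases "?Z = {}")
        case True
        then show ?thesis
          by (simp only: finite.emptyI)
      next
        case False
        then obtain i where i: "i \<in> ?Z"
          by blast
        have "?Z \<subseteq> {i}"
          using unique[OF _ i] by blast
        then show ?thesis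
          by (rule finite_subset) simp
      qed
      then have "finite (insert (f e, 0) ((\<lambda>(x, n). (f x, n)) ` ?Z \<union> (\<lambda>(x, n). (f x, n - 1)) ` ?Z))"
        by (intro finite.insertI finite_UnI finite_imageI)
      moreover have "{p \<in> ?P. ?ch e p} \<subseteq> insert (f e, 0)
          ((\<lambda>(x, n). (f x, n)) ` ?Z \<union> (\<lambda>(x, n). (f x, n - 1)) ` ?Z)"
      proof
        fix p assume p: "p \<in> {p \<in> ?P. ?ch e p}"
        obtain \<alpha> n where p_eq: "p = (\<alpha>, n)"
          by (cases p)
        have \<alpha>: "\<alpha> < l" and ch: "?ch e (\<alpha>, n)"
          using p unfolding p_eq by auto
        from ch_D[OF \<alpha> ch] consider "e = g \<alpha>" "n = 0" | "(g \<alpha>, Suc n) \<in> ?Z" | "(g \<alpha>, n) \<in> ?Z"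
          using gX[OF \<alpha>] by blast
        then show "p \<in> insert (f e, 0)
          ((\<lambda>(x, n). (f x, n)) ` ?Z \<union> (\<lambda>(x, n). (f x, n - 1)) ` ?Z)"
        proof cases
          case 1
          then show ?thesis
            using fg[OF \<alpha>] by (simp add: p_eq)
        next
          case 2
          then have "(\<lambda>(x, n). (f x, n - 1)) (g \<alpha>, Suc n) \<in> (\<lambda>(x, n). (f x, n - 1)) ` ?Z"
            by (rule imageI)
          then show ?thesis
            using fg[OF \<alpha>] by (simp add: p_eq)
        next
          case 3
          then have "(\<lambda>(x, n). (f x, n)) (g \<alpha>, n) \<in> (\<lambda>(x, n). (f x, n)) ` ?Z"
            by (rule imageI)
          then show ?thesis
            using fg[OF \<alpha>] by (simp add: p_eq)
        qed
      qed
      ultimately show ?thesis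
        by (rule finite_subset[rotated])
    qed
    show "\<exists>q\<in>?P. q < p \<and> ?ch e q" if p: "p \<in> ?P" and e: "e \<in> G p" for p e
    proof -
      obtain \<beta> m where p_eq: "p = (\<beta>, m)" and \<beta>: "\<beta> < l"
        using p by (cases p) auto
      obtain q where "fst q < l" "q < (\<beta>, m)" "?ch e q"
        using first[of e \<beta> m] e \<beta> unfolding p_eq by blast
      then show ?thesis
        unfolding p_eq by (intro bexI[of _ q]) (auto simp: mem_Times_iff)
    qed
    show "\<exists>q\<in>?P. ?ch e q" if e: "e \<in> X" for e
    proof -
      obtain q where "fst q < l" "?ch e q"
        using first[of e l 0] e unfolding G_l by blast
      then show ?thesis
        by (intro bexI[of _ q]) (auto simp: mem_Times_iff)
    qed
    \<comment> \<open>The state after \<open>(\<alpha>, n)\<close> is the state before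
      \<open>(\<alpha>, Suc n)\<close>, so \<open>between\<close> supplies a change strictly after
      \<open>q\<close>.\<close>
    have coherent: "e \<in> G' q \<longleftrightarrow> e \<in> G (\<beta>, m)"
      if q: "q \<in> ?P" and lt: "q < (\<beta>, m)" and b: "\<beta> < l \<or> \<beta> = l \<and> m = 0"
        and none: "\<And>r. r \<in> ?P \<Longrightarrow> q < r \<Longrightarrow> r < (\<beta>, m) \<Longrightarrow> \<not> ?ch e r" for q \<beta> m e
    proof (rule ccontr)
      obtain \<alpha> n where q_eq: "q = (\<alpha>, n)" and \<alpha>: "\<alpha> < l"
        using q by (cases q) auto
      assume "\<not> (e \<in> G' q \<longleftrightarrow> e \<in> G (\<beta>, m))"
      moreover have "(\<alpha>, Suc n) \<le> (\<beta>, m)"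
        using lt by (auto simp: q_eq)
      ultimately obtain r where r: "fst r < l" "(\<alpha>, Suc n) \<le> r" "r < (\<beta>, m)" "?ch e r"
        using between[of \<alpha> "Suc n" \<beta> m e] \<alpha> b unfolding q_eq G' by blast
      have "q < r"
        using r(2) by (cases r) (auto simp: q_eq)
      moreover have "r \<in> ?P"
        using r(1) by (cases r) simp
      ultimately show False
        using none r(3,4) by blast
    qed
    show "e \<in> G' q \<longleftrightarrow> e \<in> G p"
      if "p \<in> ?P" "q \<in> ?P" "q < p" "\<And>r. r \<in> ?P \<Longrightarrow> q < r \<Longrightarrow> r < p \<Longrightarrow> \<not> ?ch e r" for p q e
    proof -
      have "fst p < l"
        using that(1) by (simp add: mem_Times_iff)
      then show ?thesis
        using coherent[of q "fst p" "snd p" e, unfolded prod.collapse] that(2-4) by blast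
    qed
    show "e \<in> G' q \<longleftrightarrow> e \<in> X"
      if "q \<in> ?P" "\<And>r. r \<in> ?P \<Longrightarrow> q < r \<Longrightarrow> \<not> ?ch e r" for q e
    proof -
      have "q < (l, 0)"
        using that(1) by (cases q) simp
      then show ?thesis
        using coherent[of q l 0 e, unfolded G_l] that by blast
    qed
  qed
  then show ?thesis
    by (simp add: X_def)
qed

text \<open>Well-foundedness of the order on cardinals provides a split with fewest leaving arcs.
  This minimality is what the infinite case needs.\<close>

lemma reach_closed_split:
  fixes D :: "'a pair_pre_digraph"
  assumes "Cinfinite \<kappa>" "tournament D" "splits \<kappa> D A\<^sub>0" "|pverts D| =o \<kappa>"
  shows "\<exists>E A. cycle_reachable D E \<and> tournament E \<and> splits \<kappa> E A \<and> leaving E A = {}"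
proof -
  let ?Q = "{|leaving D A| | A. splits \<kappa> D A}"
  have "|leaving D A\<^sub>0| \<in> ?Q"
    using assms(3) by blast
  from wfE_min[OF wf_ordLess this] obtain z where "z \<in> ?Q" "\<And>y. y <o z \<Longrightarrow> y \<notin> ?Q"
    by blast
  then obtain A where A: "splits \<kappa> D A" "\<And>A'. splits \<kappa> D A' \<Longrightarrow> \<not> |leaving D A'| <o |leaving D A|"
    by blast
  have min: "|leaving D A| \<le>o |leaving D A'|" if "splits \<kappa> D A'" for A'
    using A(2)[OF that] not_ordLess_iff_ordLeq[OF card_of_Well_order card_of_Well_order] by blast
  show ?thesis
  proof (cases "finite (leaving D A)")
    case True
    then show ?thesis
      using reach_closed_split_if_finite[OF assms(1,2) A(1)] by blast
  next
    case False
    have "leaving D A \<subseteq> pverts D \<times> pverts D"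
      using tournament_pair_wf[OF assms(2)]
      by (auto simp: leaving_def dest: pair_wf_digraph.in_arcsD1 pair_wf_digraph.in_arcsD2)
    then have "|leaving D A| \<le>o |pverts D \<times> pverts D|"
      by (rule card_of_mono1)
    also have "|pverts D \<times> pverts D| \<le>o \<kappa>"
      using assms(1,4)
      by (intro card_of_Times_ordLeq_infinite_Field) (auto simp: cinfinite_def ordIso_imp_ordLeq)
    finally have "|leaving D A| \<le>o \<kappa>" .
    then have reach: "cycle_reachable D (reverse_cycle D (leaving D A))"
      using reach_closed_split_if_infinite[OF assms(1,2) A(1) _ min False] by blast
    have sub: "leaving D A \<subseteq> parcs D"
      by (auto simp: leaving_def)
    \<comment> \<open>The reversal removes vertices outside \<open>A\<close> from out-neighbourhoods
      and adds vertices of \<open>A\<close>, so the symmetric differences with \<open>A\<close> only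
      shrink.\<close>
    have "splits \<kappa> (reverse_cycle D (leaving D A)) A"
      unfolding splits_def
    proof (intro conjI ballI)
      show "A \<subseteq> pverts (reverse_cycle D (leaving D A))"
        using A(1) by (simp add: splits_def reverse_cycle_def)
      fix v assume "v \<in> pverts (reverse_cycle D (leaving D A))"
      then have "|sym_diff (out_nbhd D v) A| <o \<kappa>"
        using A(1) by (simp add: splits_def reverse_cycle_def)
      then show "|sym_diff (out_nbhd (reverse_cycle D (leaving D A)) v) A| <o \<kappa>"
        by (rule small_subset) (auto simp: out_nbhd_def reverse_cycle_def leaving_def)
    qed
    moreover have "leaving (reverse_cycle D (leaving D A)) A = {}"
      by (auto simp: leaving_def reverse_cycle_def)
    ultimately show ?thesis
      using reach tournament_reverse_cycle[OF assms(2) sub] by blast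
  qed
qed

section \<open>Degrees and strong components when no arc leaves the split\<close>

lemma walk_stays_if_none_leaving:
  assumes "leaving E A = {}" "pcas x p y" "set p \<subseteq> parcs E" "x \<in> A"
  shows "y \<in> A"
  using assms(2-)
proof (induction p arbitrary: x)
  case (Cons e p)
  have "e \<notin> leaving E A"
    using assms(1) by simp
  then have "snd e \<in> A"
    using Cons.prems by (cases e) (simp add: leaving_def)
  then show ?case
    using Cons.prems by (intro Cons.IH[of "snd e"]) simp_all
qed simp

theorem theorem6p1:
  fixes \<kappa> :: "'b rel" and D :: "'a pair_pre_digraph"
  assumes "Cinfinite \<kappa>" and "tournament D" and "uniform \<kappa> D" and "|pverts D| =o \<kappa>"
  shows "\<exists>\<C> \<in> rs D. \<exists>V\<^sub>p V\<^sub>m. pverts D = V\<^sub>p \<union> V\<^sub>m \<and>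
    (\<forall>v \<in> V\<^sub>p. |in_arcs (reversed D \<C> \<restriction> V\<^sub>p) v| <o \<kappa>) \<and>
    (\<forall>v \<in> V\<^sub>m. |out_arcs (reversed D \<C> \<restriction> V\<^sub>m) v| <o \<kappa>) \<and>
    (\<forall>H \<in> pre_digraph.sccs (with_proj (reversed D \<C>)). verts H \<subseteq> V\<^sub>p \<or> verts H \<subseteq> V\<^sub>m)"
proof -
  have "pverts D \<noteq> {}"
  proof
    assume "pverts D = {}"
    then have "|pverts D| <o \<kappa>"
      using finite_small[OF assms(1), of "pverts D"] by simp
    then show False
      using assms(4) not_ordLess_ordIso by blast
  qed
  then obtain v\<^sub>0 where v\<^sub>0: "v\<^sub>0 \<in> pverts D"
    by blast
  have "out_nbhd D v\<^sub>0 \<subseteq> pverts D"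
    using tournament_pair_wf[OF assms(2)] by (auto simp: out_nbhd_def dest: pair_wf_digraph.in_arcsD2)
  then have "splits \<kappa> D (out_nbhd D v\<^sub>0)"
    using assms(3) v\<^sub>0 unfolding splits_def uniform_def by blast
  from reach_closed_split[OF assms(1,2) this assms(4)] obtain E A
    where E: "cycle_reachable D E" "tournament E" "splits \<kappa> E A" "leaving E A = {}"
    by blast
  obtain \<C> where \<C>: "reversal D \<C> E"
    using cycle_reachable_reversal[OF E(1)] by blast
  have rev: "reversed D \<C> = E" and V: "pverts E = pverts D"
    using \<C> by (rule reversed_eq, rule pverts_reversal)
  have A: "A \<subseteq> pverts E" and small: "\<And>v. v \<in> pverts E \<Longrightarrow> |sym_diff (out_nbhd E v) A| <o \<kappa>"
    using E(3) by (auto simp: splits_def)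
  \<comment> \<open>By antisymmetry an in-neighbour of \<open>v\<close> in \<open>A\<close> is
    missing from the out-neighbourhood of \<open>v\<close>.\<close>
  have ins: "|in_arcs (E \<restriction> A) v| <o \<kappa>" if v: "v \<in> A" for v
  proof -
    have "in_arcs (E \<restriction> A) v \<subseteq> (\<lambda>u. (u, v)) ` sym_diff (out_nbhd E v) A"
      using tournament_antisym[OF E(2)] by (auto simp: in_arcs_def out_nbhd_def)
    then show ?thesis
      using small_image[OF small] v A small_subset by blast
  qed
  have outs: "|out_arcs (E \<restriction> (pverts D - A)) v| <o \<kappa>" if v: "v \<in> pverts D - A" for v
  proof -
    have "out_arcs (E \<restriction> (pverts D - A)) v \<subseteq> Pair v ` sym_diff (out_nbhd E v) A"
      by (auto simp: out_arcs_def out_nbhd_def)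
    then show ?thesis
      using small_image[OF small] v V small_subset by blast
  qed
  \<comment> \<open>A component meeting both sides would contain a walk from \<open>A\<close> to its
    complement, although no arc leaves \<open>A\<close>.\<close>
  have comps: "verts H \<subseteq> A \<or> verts H \<subseteq> pverts D - A" if H: "H \<in> pre_digraph.sccs (with_proj E)" for H
  proof (rule ccontr)
    interpret pair_wf_digraph E
      using E(2) by (rule tournament_pair_wf)
    have sub: "induced_subgraph H E" and conn: "strongly_connected H"
      using H by (auto simp: sccs_def)
    have "verts H \<subseteq> pverts D"
      using sub V by (auto simp: induced_subgraph_def subgraph_def)
    moreover assume "\<not> (verts H \<subseteq> A \<or> verts H \<subseteq> pverts D - A)"
    ultimately obtain x y where xy: "x \<in> verts H" "y \<in> verts H" "x \<in> A" "y \<notin> A"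
      by blast
    then have "x \<rightarrow>\<^sup>*\<^bsub>H\<^esub> y"
      using conn by auto
    then have "x \<rightarrow>\<^sup>*\<^bsub>E\<^esub> y"
      using sub by (auto intro: reachable_mono simp: induced_subgraph_def)
    then obtain p where "awalk x p y"
      by (auto simp: reachable_awalk)
    then have "pcas x p y" "set p \<subseteq> parcs E"
      by (auto simp: awalk_def)
    then have "y \<in> A"
      using xy(3) by (rule walk_stays_if_none_leaving[OF E(4)])
    with xy(4) show False ..
  qed
  show ?thesis
  proof (intro bexI exI conjI ballI)
    show "\<C> \<in> rs D"
      using \<C> by (auto simp: rs_def)
    show "pverts D = A \<union> (pverts D - A)"
      using A V by blast
    show "|in_arcs (reversed D \<C> \<restriction> A) v| <o \<kappa>" if "v \<in> A" for v
      unfolding rev using that by (rule ins)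
    show "|out_arcs (reversed D \<C> \<restriction> (pverts D - A)) v| <o \<kappa>" if "v \<in> pverts D - A" for v
      unfolding rev using that by (rule outs)
    show "verts H \<subseteq> A \<or> verts H \<subseteq> pverts D - A"
      if "H \<in> pre_digraph.sccs (with_proj (reversed D \<C>))" for H
      using that unfolding rev by (rule comps)
  qed
qed

end
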